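(* Let $E$ be a field. Then the following conditions are equivalent: (1) $E$ has only finitely many maximal subrings. (2) Every descending chain $\cdots\subset R_2\subset R_1\subset R_0=E$, where each $R_i$ is a maximal subring of $R_{i-1}$, $i\geq 1$, is finite. Moreover, if one of these equivalent conditions holds, then all chains as in (2) that cannot be extended further (i.e. chains $R_m\subset\cdots\subset R_1\subset R_0=E$ whose last term $R_m$ has no maximal subring) have the same length $m$, and $R_m=L(E)$. Furthermore, $E$ has only finitely many chains of this form, and $m=\sum_{p\in T_f}o_T(p)$, where $T=FG(E)$.
   Context: All rings are commutative with $1\neq 0$ and subrings are unital. A proper subring $S$ of a ring $R$ is a maximal subring of $R$ if it is maximal with respect to inclusion among all proper subrings of $R$ (a subring of a field need not be a field). An absolutely algebraic field is a field that is algebraic over $\mathbb{F}_q$ for some prime $q$; regard it as a subfield of a fixed algebraic closure $\bar{\mathbb{F}}_q$. (A field with only finitely many maximal subrings is absolutely algebraic, so the notation below applies to $E$ in the final assertions.) For an absolutely algebraic field $E$ of characteristic $q$ put $FG(E)=\{n\in\mathbb{N} : \mathbb{F}_{q^n}\subseteq E\}$ (with $\mathbb N$ the positive integers). For $T=FG(E)$: $T_\infty$ is the set of primes $p$ such that $p^n\in T$ for all $n\in\mathbb{N}$; $T_f$ is the set of primes $p\in T$ such that $p\notin T_\infty$; and for $p\in T_f$, $o_T(p)$ is the largest $n\in\mathbb{N}$ with $p^n\in T$. Finally $L(E)$ denotes the subfield $\bigcup_{n\in T'}\mathbb{F}_{q^n}$ of $E$, where $T'$ is the set of all positive integers all of whose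 prime divisors lie in $T_\infty$ (so $1\in T'$). The length of a chain $R_m\subset\cdots\subset R_0$ is $m$. *)

theory Defs
  imports "HOL-Algebra.Algebraic_Closure_Type"
begin

text \<open>The field \<open>E\<close> is the type \<open>'a\<close>, so that \<open>E\<close> itself is the set \<open>UNIV\<close> and its subrings and
  subfields are sets. They are those of HOL-Algebra for the ring structure of the type; in
  particular subrings contain \<open>1\<close>.\<close>

abbreviation is_subring :: "'a::field set \<Rightarrow> bool"
  where "is_subring S \<equiv> subring S (ring_of_type_algebra :: 'a ring)"

abbreviation is_subfield :: "'a::field set \<Rightarrow> bool"
  where "is_subfield K \<equiv> subfield K (ring_of_type_algebra :: 'a ring)"

lemma a_inv_ring_of_type_algebra:
  "a_inv (ring_of_type_algebra :: 'a::field ring) x = - x"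
proof -
  interpret R: field "ring_of_type_algebra :: 'a ring" by (rule field_from_type_algebra)
  show ?thesis
    by (rule R.minus_equality) (auto simp: ring_of_type_algebra_def)
qed

lemma is_subring_iff:
  fixes S :: "'a::field set"
  shows "is_subring S \<longleftrightarrow> 1 \<in> S \<and> (\<forall>x\<in>S. \<forall>y\<in>S. x - y \<in> S \<and> x * y \<in> S)"
proof
  assume S: "is_subring S"
  have *: "- x \<in> S" if "x \<in> S" for x
    using subringE(5)[OF S that] by (simp add: a_inv_ring_of_type_algebra)
  have "x - y \<in> S" if "x \<in> S" "y \<in> S" for x y
    using subringE(7)[OF S that(1) *[OF that(2)]] by (simp add: ring_of_type_algebra_def)
  with subringE(3,6)[OF S] show "1 \<in> S \<and> (\<forall>x\<in>S. \<forall>y\<in>S. x - y \<in> S \<and> x * y \<in> S)"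
    by (simp add: ring_of_type_algebra_def)
next
  assume S: "1 \<in> S \<and> (\<forall>x\<in>S. \<forall>y\<in>S. x - y \<in> S \<and> x * y \<in> S)"
  then have zero: "0 \<in> S" by (metis diff_self)
  with S have neg: "- x \<in> S" if "x \<in> S" for x
    using that by (metis diff_0)
  with S have add: "x + y \<in> S" if "x \<in> S" "y \<in> S" for x y
    using that by (metis diff_minus_eq_add)
  interpret R: field "ring_of_type_algebra :: 'a ring" by (rule field_from_type_algebra)
  show "is_subring S"
  proof (rule R.subringI)
    show "a_inv ring_of_type_algebra h \<in> S" if "h \<in> S" for h
      using neg[OF that] by (simp add: a_inv_ring_of_type_algebra)
  qed (use S add in \<open>auto simp: ring_of_type_algebra_def\<close>)
qed

definition maximal_subring :: "'a::field set \<Rightarrow> 'a set \<Rightarrow> bool"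
  where "maximal_subring S R \<longleftrightarrow> is_subring S \<and> S \<subset> R \<and>
    (\<forall>S'. is_subring S' \<and> S' \<subset> R \<and> S \<subseteq> S' \<longrightarrow> S' = S)"

text \<open>A finite chain \<open>R\<^sub>m \<subset> \<dots> \<subset> R\<^sub>0 = E\<close> is the list \<open>[R\<^sub>0, \<dots>, R\<^sub>m]\<close>; its length as a
  list is \<open>m + 1\<close>.\<close>

definition maximal_subring_chain :: "'a::field set list \<Rightarrow> bool"
  where "maximal_subring_chain Rs \<longleftrightarrow> Rs \<noteq> [] \<and> hd Rs = UNIV \<and>
    (\<forall>i. Suc i < length Rs \<longrightarrow> maximal_subring (Rs ! Suc i) (Rs ! i))"

definition unextendable_chain :: "'a::field set list \<Rightarrow> bool"
  where "unextendable_chain Rs \<longleftrightarrow>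
    maximal_subring_chain Rs \<and> \<not> (\<exists>S. maximal_subring S (last Rs))"

definition infinite_maximal_subring_chain :: "(nat \<Rightarrow> 'a::field set) \<Rightarrow> bool"
  where "infinite_maximal_subring_chain R \<longleftrightarrow>
    R 0 = UNIV \<and> (\<forall>i. maximal_subring (R (Suc i)) (R i))"

text \<open>The copy of \<open>\<F>\<^bsub>q^n\<^esub>\<close> in \<open>E\<close>, where \<open>q\<close> is the characteristic of \<open>E\<close>: \<open>K\<close> is the
  subfield of \<open>E\<close> with \<open>q\<^sup>n\<close> elements. There is at most one such \<open>K\<close>, and there is one iff the field
  with \<open>q\<^sup>n\<close> elements in an algebraic closure of \<open>E\<close> lies in \<open>E\<close>. Finiteness of \<open>K\<close> only matters
  in characteristic \<open>0\<close>, where \<open>card\<close> is \<open>0\<close> for infinite sets.\<close>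

definition is_GF :: "nat \<Rightarrow> 'a::field set \<Rightarrow> bool"
  where "is_GF n K \<longleftrightarrow> is_subfield K \<and> finite K \<and> card K = CHAR('a) ^ n"

definition FG :: "'a::field itself \<Rightarrow> nat set"
  where "FG _ = {n. n > 0 \<and> (\<exists>K :: 'a set. is_GF n K)}"

definition T_inf :: "nat set \<Rightarrow> nat set"
  where "T_inf T = {p. prime p \<and> (\<forall>n>0. p ^ n \<in> T)}"

definition T_fin :: "nat set \<Rightarrow> nat set"
  where "T_fin T = {p \<in> T. prime p \<and> p \<notin> T_inf T}"

definition o_exp :: "nat set \<Rightarrow> nat \<Rightarrow> nat"
  where "o_exp T p = (GREATEST n. n > 0 \<and> p ^ n \<in> T)"

definition T_prime :: "nat set \<Rightarrow> nat set"
  where "T_prime T = {n. n > 0 \<and> (\<forall>p. prime p \<and> p dvd n \<longrightarrow> p \<in> T_inf T)}"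

definition L_field :: "'a::field set"
  where "L_field = \<Union>{K. \<exists>n \<in> T_prime (FG TYPE('a)). is_GF n K}"

end

theory Submission
  imports Defs "HOL-Number_Theory.Cong"
begin

text \<open>Let \<open>q\<close> be the characteristic of the field \<open>E\<close>. There are two cases, and in each of them both
conditions can be decided outright.

If \<open>E\<close> is not absolutely algebraic, both conditions fail. Call \<open>a \<noteq> 0\<close> good if some maximal subring
\<open>V\<close> of \<open>E\<close> contains \<open>a\<close> but not \<open>1/a\<close>. A subring that is maximal among those without \<open>1/a\<close> is a
valuation ring, and it is a maximal subring as soon as every element of \<open>E\<close> is carried into it by a
power of \<open>a\<close>. Starting from a localization of \<open>K[x]\<close> or of \<open>\<int>\<close> one finds in this way that
elements transcendental over the prime field are good, and that every integer \<open>n > 1\<close> is good if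
\<open>E\<close> is algebraic over the rationals. Both kinds of elements are preserved by
\<open>s \<mapsto> 1 - s + s\<^sup>2\<close>, whose iterates are pairwise comaximal. Hence there are maximal subrings
\<open>V\<^sub>0, V\<^sub>1, \<dots>\<close> of rank one with nonunits \<open>a\<^sub>i \<in> V\<^sub>i\<close> such that \<open>a\<^sub>i\<close> is a unit in every other
\<open>V\<^sub>j\<close>. They are distinct, and by weak approximation \<open>V\<^sub>0 \<inter> \<dots> \<inter> V\<^sub>n\<close> is a maximal subring of
\<open>V\<^sub>0 \<inter> \<dots> \<inter> V\<^bsub>n-1\<^esub>\<close>, which gives an infinite chain.

If \<open>E\<close> is absolutely algebraic, assign to \<open>x\<close> its degree over the prime field, the least \<open>n > 0\<close>
with \<open>x^(q^n) = x\<close>. A subring \<open>S\<close> that contains \<open>x\<close> contains the field with \<open>q^n\<close> elements, by a count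
of the values at \<open>x\<close> of polynomials of degree less than \<open>n\<close>. It follows that \<open>S\<close> is determined by the
set of degrees of its elements, that these sets are exactly the subsets of \<open>T = FG(E)\<close> that contain \<open>1\<close>
and are closed under divisors and least common multiples, and that \<open>E\<close> itself has the set \<open>T\<close>.
The problem is now one about such ideals \<open>D\<close> of natural numbers.
The maximal ideals below \<open>D\<close> arise by removing the multiples of \<open>p^o\<close>, where \<open>p\<close> is a prime in \<open>D\<close>
and \<open>p^o\<close> is the largest power of \<open>p\<close> in \<open>D\<close>. So there is one for each \<open>p\<close> in \<open>T_fin D\<close>, and passing to it
deletes exactly one pair from the set of all \<open>(p, k)\<close> with \<open>p\<close> in \<open>T_fin D\<close> and \<open>1 \<le> k \<le> o\<close>, while
\<open>T_inf D\<close> does not change. If \<open>T_fin T\<close> is infinite, there are infinitely many maximal subrings, and the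
deletion can be repeated forever. If it is finite, a chain stops exactly when all pairs have been
deleted; this takes \<open>\<Sum> o_T(p)\<close> steps and leaves the numbers all of whose prime divisors lie in
\<open>T_inf T\<close>, that is, the degrees of the elements of \<open>L(E)\<close>.\<close>

section \<open>Subrings\<close>

lemma subringD:
  assumes "is_subring S"
  shows "1 \<in> S" "0 \<in> S" "x \<in> S \<Longrightarrow> y \<in> S \<Longrightarrow> x - y \<in> S" "x \<in> S \<Longrightarrow> y \<in> S \<Longrightarrow> x * y \<in> S"
    "x \<in> S \<Longrightarrow> - x \<in> S" "x \<in> S \<Longrightarrow> y \<in> S \<Longrightarrow> x + y \<in> S" "x \<in> S \<Longrightarrow> x ^ n \<in> S"
    "of_nat k \<in> S" "of_int z \<in> S"
proof -
  show 1: "1 \<in> S" and diff: "\<And>x y. x \<in> S \<Longrightarrow> y \<in> S \<Longrightarrow> x - y \<in> S"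
    and mult: "\<And>x y. x \<in> S \<Longrightarrow> y \<in> S \<Longrightarrow> x * y \<in> S"
    using assms by (auto simp: is_subring_iff)
  show 0: "0 \<in> S" using diff[OF 1 1] by simp
  show neg: "- x \<in> S" if "x \<in> S" for x using diff[OF 0 that] by simp
  show add: "x + y \<in> S" if "x \<in> S" "y \<in> S" for x y using diff[OF that(1) neg[OF that(2)]] by simp
  show "x ^ n \<in> S" if "x \<in> S" for x by (induction n) (auto simp: 1 mult that)
  show nat: "of_nat k \<in> S" for k by (induction k) (auto simp: 0 1 add)
  show "of_int z \<in> S" by (cases z rule: int_diff_cases) (auto simp: nat diff)
qed

lemma subring_sum:
  assumes S: "is_subring S"
  shows "(\<And>i. i \<in> I \<Longrightarrow> f i \<in> S) \<Longrightarrow> sum f I \<in> S"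
proof (induction I rule: infinite_finite_induct)
  case (insert i I)
  then have "f i \<in> S" "sum f I \<in> S" by blast+
  then show ?case using insert.hyps by (simp add: subringD[OF S])
qed (simp_all add: subringD[OF S])

lemma subring_prod:
  assumes S: "is_subring S"
  shows "(\<And>i. i \<in> I \<Longrightarrow> f i \<in> S) \<Longrightarrow> prod f I \<in> S"
proof (induction I rule: infinite_finite_induct)
  case (insert i I)
  then have "f i \<in> S" "prod f I \<in> S" by blast+
  then show ?case using insert.hyps by (simp add: subringD[OF S])
qed (simp_all add: subringD[OF S])

lemma is_subring_prime_ring: "is_subring (range of_int :: 'a::field set)"
    unfolding is_subring_iff
  proof (intro conjI ballI)
    show "(1::'a) \<in> range of_int" by (metis of_int_1 rangeI)
    fix x y :: 'a assume "x \<in> range of_int" "y \<in> range of_int"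
    then obtain i j where "x = of_int i" "y = of_int j" by blast
    then have "x - y = of_int (i - j)" "x * y = of_int (i * j)" by simp_all
    then show "x - y \<in> range of_int" "x * y \<in> range of_int" by blast+
  qed

lemma is_subring_UNIV: "is_subring UNIV"
  by (simp add: is_subring_iff)

lemma is_subring_Inter: "\<C> \<noteq> {} \<Longrightarrow> (\<And>S. S \<in> \<C> \<Longrightarrow> is_subring S) \<Longrightarrow> is_subring (\<Inter>\<C>)"
  by (auto simp: is_subring_iff)

lemma is_subring_Union_chain:
  assumes "\<C> \<noteq> {}" "\<And>S. S \<in> \<C> \<Longrightarrow> is_subring S" "subset.chain \<A> \<C>"
  shows "is_subring (\<Union>\<C>)"
  unfolding is_subring_iff
proof (intro conjI ballI)
  obtain S where "S \<in> \<C>" using assms(1) by blast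
  then show "1 \<in> \<Union>\<C>" using subringD(1)[OF assms(2)[of S]] by blast
  fix x y assume "x \<in> \<Union>\<C>" "y \<in> \<Union>\<C>"
  then obtain S S' where S: "S \<in> \<C>" "x \<in> S" "S' \<in> \<C>" "y \<in> S'" by blast
  then have "S \<subseteq> S' \<or> S' \<subseteq> S" using assms(3) unfolding subset.chain_def by blast
  then obtain B where "B \<in> \<C>" "x \<in> B" "y \<in> B" using S by blast
  with subringD(3,4)[OF assms(2)[of B], of x y]
  have "x - y \<in> B" "x * y \<in> B" by simp_all
  then show "x - y \<in> \<Union>\<C>" "x * y \<in> \<Union>\<C>" using \<open>B \<in> \<C>\<close> by blast+
qed

section \<open>Polynomials over a subring\<close>

definition polys_over :: "'a::field set \<Rightarrow> 'a poly set"
  where "polys_over A = {f. \<forall>i. poly.coeff f i \<in> A}"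

definition adjoin :: "'a::field set \<Rightarrow> 'a \<Rightarrow> 'a set"
  where "adjoin A t = (\<lambda>f. poly f t) ` polys_over A"

lemma polys_overD: "f \<in> polys_over A \<Longrightarrow> poly.coeff f i \<in> A"
  by (simp add: polys_over_def)

lemma polys_over_mono: "A \<subseteq> B \<Longrightarrow> polys_over A \<subseteq> polys_over B"
  by (auto simp: polys_over_def)

lemma polys_over_closed:
  assumes A: "is_subring A"
  shows "0 \<in> polys_over A" "1 \<in> polys_over A"
    "f \<in> polys_over A \<Longrightarrow> g \<in> polys_over A \<Longrightarrow> f + g \<in> polys_over A"
    "f \<in> polys_over A \<Longrightarrow> g \<in> polys_over A \<Longrightarrow> f - g \<in> polys_over A"
    "f \<in> polys_over A \<Longrightarrow> g \<in> polys_over A \<Longrightarrow> f * g \<in> polys_over A"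
    "c \<in> A \<Longrightarrow> f \<in> polys_over A \<Longrightarrow> smult c f \<in> polys_over A"
    "c \<in> A \<Longrightarrow> f \<in> polys_over A \<Longrightarrow> pCons c f \<in> polys_over A"
    "c \<in> A \<Longrightarrow> monom c n \<in> polys_over A"
    "f \<in> polys_over A \<Longrightarrow> f ^ n \<in> polys_over A"
proof -
  show 1: "1 \<in> polys_over A" by (auto simp: polys_over_def coeff_1 subringD[OF A])
  show mult: "f * g \<in> polys_over A" if "f \<in> polys_over A" "g \<in> polys_over A" for f g
    using that by (auto simp: polys_over_def coeff_mult intro!: subring_sum[OF A] subringD(4)[OF A])
  show "f ^ n \<in> polys_over A" if "f \<in> polys_over A" for f
    by (induction n) (auto simp: 1 mult that)
qed (auto simp: polys_over_def coeff_pCons subringD[OF A] split: nat.split)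

lemma sum_in_polys_over:
  assumes A: "is_subring A"
  shows "(\<And>i. i \<in> I \<Longrightarrow> f i \<in> polys_over A) \<Longrightarrow> sum f I \<in> polys_over A"
proof (induction I rule: infinite_finite_induct)
  case (insert i I)
  then have "f i \<in> polys_over A" "sum f I \<in> polys_over A" by blast+
  then show ?case using insert.hyps by (simp add: polys_over_closed[OF A])
qed (simp_all add: polys_over_closed[OF A])

lemma pcompose_in_polys_over:
  assumes A: "is_subring A" and g: "g \<in> polys_over A"
  shows "f \<in> polys_over A \<Longrightarrow> pcompose f g \<in> polys_over A"
proof (induction f)
  case (pCons a f)
  then have "poly.coeff (pCons a f) 0 \<in> A" "\<And>i. poly.coeff (pCons a f) (Suc i) \<in> A"
    unfolding polys_over_def by blast+
  then have "a \<in> A" "f \<in> polys_over A" by (auto simp: polys_over_def)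
  then show ?case
    using pCons.IH g by (auto simp: pcompose_pCons intro!: polys_over_closed[OF A])
qed (auto simp: polys_over_closed[OF A])

lemma poly_in_subring:
  assumes "is_subring A" "f \<in> polys_over A" "t \<in> A"
  shows "poly f t \<in> A"
  unfolding poly_altdef 
  by (rule subring_sum[OF assms(1)], rule subringD(4)[OF assms(1)], rule polys_overD[OF assms(2)],
      rule subringD(7)[OF assms(1,3)])

lemma is_subring_adjoin:
  assumes A: "is_subring A"
  shows "is_subring (adjoin A t)"
  unfolding is_subring_iff
proof (intro conjI ballI)
  show "1 \<in> adjoin A t" unfolding adjoin_def
    by (rule image_eqI[of _ _ 1]) (auto simp: polys_over_closed[OF A])
  fix x y assume "x \<in> adjoin A t" "y \<in> adjoin A t"
  then obtain f g where fg: "f \<in> polys_over A" "g \<in> polys_over A" "x = poly f t" "y = poly g t"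
    by (auto simp: adjoin_def)
  show "x - y \<in> adjoin A t" unfolding adjoin_def
    by (rule image_eqI[of _ _ "f - g"]) (auto simp: fg polys_over_closed[OF A])
  show "x * y \<in> adjoin A t" unfolding adjoin_def
    by (rule image_eqI[of _ _ "f * g"]) (auto simp: fg polys_over_closed[OF A])
qed

lemma subset_adjoin:
  assumes A: "is_subring A"
  shows "A \<subseteq> adjoin A t" and "t \<in> adjoin A t"
proof -
  show "t \<in> adjoin A t" unfolding adjoin_def
    by (rule image_eqI[of _ _ "[:0, 1:]"]) (auto intro!: polys_over_closed[OF A] subringD[OF A])
  show "A \<subseteq> adjoin A t"
  proof
    fix a assume "a \<in> A"
    then show "a \<in> adjoin A t" unfolding adjoin_def
      by (intro image_eqI[of _ _ "[:a:]"]) (auto intro!: polys_over_closed[OF A] subringD[OF A])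
  qed
qed

section \<open>Subrings maximal without a given inverse\<close>

text \<open>For \<open>b = 1/a\<close> with \<open>a\<close> in \<open>V\<close> this describes the valuation rings of the field whose maximal ideal is the
only prime ideal that contains \<open>a\<close>, in a form that Zorn's lemma provides directly.\<close>
definition max_omitting :: "'a::field \<Rightarrow> 'a set \<Rightarrow> bool"
  where "max_omitting b V \<longleftrightarrow> is_subring V \<and> b \<notin> V \<and> (\<forall>W. is_subring W \<and> V \<subset> W \<longrightarrow> b \<in> W)"

lemma ex_max_omitting:
  assumes A: "is_subring A" "b \<notin> A"
  shows "\<exists>V. max_omitting b V \<and> A \<subseteq> V"
proof -
  define \<A> where "\<A> = {W. is_subring W \<and> A \<subseteq> W \<and> b \<notin> W}"
  have "\<exists>M\<in>\<A>. \<forall>B\<in>\<A>. M \<subseteq> B \<longrightarrow> B = M"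
  proof (rule subset_Zorn_nonempty)
    show "\<A> \<noteq> {}" using A by (auto simp: \<A>_def)
    fix \<C> assume \<C>: "\<C> \<noteq> {}" "subset.chain \<A> \<C>"
    then have "\<And>S. S \<in> \<C> \<Longrightarrow> S \<in> \<A>" by (auto simp: subset.chain_def)
    then show "\<Union>\<C> \<in> \<A>"
      using \<C> is_subring_Union_chain[OF \<C>(1) _ \<C>(2)] by (auto simp: \<A>_def)
  qed
  then obtain V where "V \<in> \<A>" "\<forall>B\<in>\<A>. V \<subseteq> B \<longrightarrow> B = V" by blast
  then show ?thesis unfolding \<A>_def max_omitting_def by blast
qed

text \<open>This is the part of "V is local" that is needed: adjoining the inverse of \<open>u = 1 - a b\<close> does not make
\<open>a\<close> invertible. Otherwise \<open>u^n / a\<close> would lie in \<open>V\<close> for some \<open>n\<close>, but \<open>u^n\<close> is \<open>1\<close> modulo \<open>a\<close>.\<close>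
lemma inverse_one_minus_in:
  assumes V: "max_omitting (inverse a) V" and a: "a \<in> V" and b: "b \<in> V"
  shows "inverse (1 - a * b) \<in> V"
proof (rule ccontr)
  assume out: "inverse (1 - a * b) \<notin> V"
  have sub: "is_subring V" and aV: "inverse a \<notin> V" using V by (auto simp: max_omitting_def)
  \<comment> \<open>Clearing the denominators \<open>u\<close> in \<open>inverse a \<in> V[inverse u]\<close> turns the polynomial into its reflection.\<close>
  define u where "u = 1 - a * b"
  have u: "u \<in> V" using a b by (auto simp: u_def intro!: subringD[OF sub])
  have u0: "u \<noteq> 0" using out subringD(2)[OF sub] by (auto simp: u_def)
  have a0: "a \<noteq> 0" using aV subringD(2)[OF sub] by auto
  have "V \<subset> adjoin V (inverse u)"
    using subset_adjoin[OF sub, of "inverse u"] out by (auto simp: u_def)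
  with V is_subring_adjoin[OF sub] have "inverse a \<in> adjoin V (inverse u)"
    by (auto simp: max_omitting_def)
  then obtain f where f: "f \<in> polys_over V" "inverse a = poly f (inverse u)"
    by (auto simp: adjoin_def)
  define n where "n = Polynomial.degree f"
  have "u ^ n * poly f (inverse u) = poly (reflect_poly f) u"
    using u0 by (simp add: poly_reflect_poly_nz n_def)
  also have "reflect_poly f \<in> polys_over V"
    using f(1) subringD(2)[OF sub] by (auto simp: polys_over_def coeff_reflect_poly)
  then have "poly (reflect_poly f) u \<in> V" by (rule poly_in_subring[OF sub _ u])
  finally have "u ^ n * inverse a \<in> V" using f(2) by simp
  moreover have "\<exists>c\<in>V. u ^ n = 1 - a * c"
  proof (induction n)
    case 0
    then show ?case using subringD(2)[OF sub] by force
  next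
    case (Suc n)
    then obtain c where c: "c \<in> V" "u ^ n = 1 - a * c" by blast
    have "u ^ Suc n = 1 - a * (b + c - a * b * c)" unfolding power_Suc c(2) by (simp add: u_def algebra_simps)
    moreover have "b + c - a * b * c \<in> V" using a b c(1) by (intro subringD[OF sub])
    ultimately show ?case by blast
  qed
  then obtain c where c: "c \<in> V" "u ^ n = 1 - a * c" by blast
  ultimately have "(1 - a * c) * inverse a + c \<in> V" using subringD(6)[OF sub] by auto
  moreover have "(1 - a * c) * inverse a + c = inverse a" using a0 by (simp add: field_simps)
  ultimately show False using aV by simp
qed

text \<open>One step of polynomial division by a divisor with leading coefficient \<open>1\<close>, which keeps the
coefficients in a given subring.\<close>
lemma degree_drop:
  fixes f h :: "'a::field poly"
  assumes "Polynomial.degree f = n" "n > 0" "Polynomial.degree h = m" "m \<le> n" "poly.coeff h m = 1"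
  shows "Polynomial.degree (f - monom (poly.coeff f n) (n - m) * h) < n"
proof -
  define g where "g = f - monom (poly.coeff f n) (n - m) * h"
  have "Polynomial.degree (monom (poly.coeff f n) (n - m) * h) \<le> n"
    using degree_mult_le[of "monom (poly.coeff f n) (n - m)" h] degree_monom_le[of "poly.coeff f n" "n - m"]
      assms(3,4) by linarith
  then have "Polynomial.degree g \<le> n" using assms(1) by (simp add: g_def degree_diff_le)
  moreover have "poly.coeff g n = 0"
    using assms(4,5) by (simp add: g_def coeff_monom_mult)
  ultimately show ?thesis
    using assms(2) by (metis g_def eq_zero_or_degree_less degree_0)
qed

text \<open>The classical argument that such a ring is a valuation ring. If neither \<open>t\<close> nor \<open>1/t\<close> is in \<open>V\<close>, then
\<open>1/a\<close> is a polynomial in \<open>t\<close> and also a polynomial in \<open>1/t\<close>; take both of minimal degree. Since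
\<open>1 - a c\<close> is a unit for the constant term \<open>c\<close>, the relation of smaller degree yields a monic equation for
\<open>t\<close> or \<open>1/t\<close>, and this equation shortens the other relation.\<close>
lemma max_omitting_valuation:
  assumes V: "max_omitting (inverse a) V" and a: "a \<in> V"
  shows "t \<in> V \<or> inverse t \<in> V"
proof (rule ccontr)
  assume not: "\<not> (t \<in> V \<or> inverse t \<in> V)"
  have sub: "is_subring V" and aV: "inverse a \<notin> V" using V by (auto simp: max_omitting_def)
  have a0: "a \<noteq> 0" using aV subringD(2)[OF sub] by auto
  define R where "R t f \<longleftrightarrow> f \<in> polys_over V \<and> a * poly f t = 1" for t f
  define d where "d t = (LEAST n. \<exists>f. R t f \<and> Polynomial.degree f = n)" for t
  have ex: "\<exists>f. R t f" if "t \<notin> V" for t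
  proof -
    have "V \<subset> adjoin V t" using subset_adjoin[OF sub, of t] that by auto
    with V is_subring_adjoin[OF sub] have "inverse a \<in> adjoin V t" by (auto simp: max_omitting_def)
    then obtain f where "f \<in> polys_over V" "inverse a = poly f t" by (auto simp: adjoin_def)
    then have "R t f" using a0 unfolding R_def by (metis right_inverse)
    then show ?thesis by blast
  qed
  have d: "\<exists>f. R t f \<and> Polynomial.degree f = d t" if "t \<notin> V" for t
    unfolding d_def by (rule LeastI_ex[of "\<lambda>n. \<exists>f. R t f \<and> Polynomial.degree f = n"]) (use ex[OF that] in blast)
  have least: "d t \<le> Polynomial.degree f" if "R t f" for t f
    unfolding d_def by (rule Least_le) (use that in blast)
  have False if t: "t \<notin> V" "inverse t \<notin> V" "d (inverse t) \<le> d t" for t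
  proof -
    have t0: "t \<noteq> 0" using t(1) subringD(2)[OF sub] by auto
    obtain f where f: "R t f" "Polynomial.degree f = d t" using d[OF t(1)] by blast
    obtain g where g: "R (inverse t) g" "Polynomial.degree g = d (inverse t)" using d[OF t(2)] by blast
    define m where "m = d (inverse t)"
    define u where "u = inverse (1 - a * poly.coeff g 0)"
    have g0: "poly.coeff g 0 \<in> V" using g(1) by (simp add: R_def polys_over_def)
    have u: "u \<in> V" unfolding u_def by (rule inverse_one_minus_in[OF V a g0])
    have "1 - a * poly.coeff g 0 \<noteq> 0"
    proof
      assume "1 - a * poly.coeff g 0 = 0"
      then have "poly.coeff g 0 = inverse a" using a0 by (simp add: field_simps)
      then show False using g0 aV by simp
    qed
    then have u1: "u * (1 - a * poly.coeff g 0) = 1" by (simp add: u_def)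
    \<comment> \<open>The relation \<open>1 = a * g(1/t)\<close>, multiplied by \<open>t ^ m\<close> and normalized, is the monic equation \<open>h(t) = 0\<close>.\<close>
    define h where "h = smult u (monom 1 m - smult a (reflect_poly g))"
    have h: "h \<in> polys_over V" "poly h t = 0" "poly.coeff h m = 1"
    proof -
      have "reflect_poly g \<in> polys_over V"
        using g(1) subringD(2)[OF sub] by (auto simp: R_def polys_over_def coeff_reflect_poly)
      then show "h \<in> polys_over V"
        unfolding h_def using u a by (intro polys_over_closed[OF sub] subringD[OF sub])
      have "poly (reflect_poly g) t = t ^ m * poly g (inverse t)"
        using t0 g(2) by (simp add: poly_reflect_poly_nz m_def)
      then have "a * poly (reflect_poly g) t = t ^ m" using g(1) by (simp add: R_def mult_ac)
      then show "poly h t = 0" by (simp add: h_def poly_monom)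
      show "poly.coeff h m = 1" using u1 g(2) by (simp add: h_def coeff_reflect_poly m_def)
    qed
    have "Polynomial.degree h \<le> m"
      unfolding h_def using g(2)
      by (intro order_trans[OF degree_smult_le] degree_diff_le degree_monom_le)
        (use degree_reflect_poly_le[of g] in
          \<open>auto simp: m_def intro: order_trans[OF degree_smult_le]\<close>)
    then have hm: "Polynomial.degree h = m" using h(3) by (metis le_antisym le_degree zero_neq_one)
    have "d t > 0"
    proof (rule ccontr)
      assume "\<not> d t > 0"
      then obtain c where "f = [:c:]" using f(2) by (metis degree_eq_zeroE neq0_conv)
      then have "c \<in> V" "a * c = 1" using f(1) polys_overD[of f V 0] by (auto simp: R_def)
      then show False using aV a0 by (metis inverse_unique)
    qed
    let ?f = "f - monom (poly.coeff f (d t)) (d t - m) * h"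
    have "Polynomial.degree ?f < d t"
      by (rule degree_drop) (use f(2) \<open>d t > 0\<close> hm t(3) h(3) in \<open>auto simp: m_def\<close>)
    moreover have "R t ?f"
      using f(1) h by (auto simp: R_def intro!: polys_over_closed[OF sub] polys_overD)
    ultimately show False using least by (meson not_le)
  qed
  from this[of t] this[of "inverse t"] not show False by (cases "d (inverse t) \<le> d t") auto
qed

text \<open>Divide the equation for \<open>e\<close> by \<open>e^(n-1)\<close>: if \<open>e\<close> is not in \<open>V\<close>, then \<open>1/e\<close> is, and the leading term is
a polynomial in \<open>1/e\<close>. For a monic \<open>f\<close> this says that valuation rings are integrally closed.\<close>
lemma lead_coeff_times_root_in:
  assumes sub: "is_subring V" and val: "e \<in> V \<or> inverse e \<in> V"
    and f: "f \<in> polys_over V" "f \<noteq> 0" "poly f e = 0"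
  shows "Polynomial.lead_coeff f * e \<in> V"
proof (cases "e \<in> V")
  case True
  then show ?thesis using f by (auto intro!: subringD[OF sub] polys_overD)
next
  case False
  define s where "s = inverse e"
  have s: "s \<in> V" using False val by (simp add: s_def)
  have e0: "e \<noteq> 0" using False subringD(2)[OF sub] by auto
  define n where "n = Polynomial.degree f"
  have "n \<noteq> 0"
  proof
    assume "n = 0"
    then obtain c where "f = [:c:]" by (metis n_def degree_eq_zeroE)
    then show False using f by auto
  qed
  then obtain m where m: "n = Suc m" by (cases n) auto
  have "0 = s ^ m * poly f e" using f(3) by simp
  also have "\<dots> = s ^ m * (\<Sum>i\<le>n. poly.coeff f i * e ^ i)" by (simp add: poly_altdef n_def)
  also have "\<dots> = s ^ m * (poly.coeff f n * e ^ n) + (\<Sum>i\<le>m. s ^ m * (poly.coeff f i * e ^ i))"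
    by (simp add: m sum_distrib_left distrib_left)
  also have "s ^ m * (poly.coeff f n * e ^ n) = poly.coeff f n * e"
    using e0 by (simp add: m s_def power_inverse field_simps)
  also have "(\<Sum>i\<le>m. s ^ m * (poly.coeff f i * e ^ i)) = (\<Sum>i\<le>m. poly.coeff f i * s ^ (m - i))"
  proof (rule sum.cong)
    fix i assume "i \<in> {..m}"
    then have "s ^ m = s ^ (m - i) * s ^ i" by (simp flip: power_add)
    then show "s ^ m * (poly.coeff f i * e ^ i) = poly.coeff f i * s ^ (m - i)"
      using e0 by (simp add: s_def power_inverse)
  qed simp
  finally have "poly.coeff f n * e = - (\<Sum>i\<le>m. poly.coeff f i * s ^ (m - i))"
    by (simp add: eq_neg_iff_add_eq_0)
  also have "\<dots> \<in> V" using s f(1) by (auto intro!: subringD[OF sub] subring_sum[OF sub] polys_overD)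
  finally show ?thesis by (simp add: n_def)
qed

text \<open>In a field \<open>inverse 0 = 0\<close>, so that \<open>inverse a \<notin> V\<close> includes \<open>a \<noteq> 0\<close>.\<close>
definition maximal_subring_nonunit :: "'a::field \<Rightarrow> 'a set \<Rightarrow> bool"
  where "maximal_subring_nonunit a V \<longleftrightarrow> maximal_subring V UNIV \<and> a \<in> V \<and> inverse a \<notin> V"

lemma maximal_subring_nonunitD:
  assumes "maximal_subring_nonunit a V"
  shows "is_subring V" "a \<in> V" "inverse a \<notin> V"
  using assms unfolding maximal_subring_nonunit_def maximal_subring_def by blast+

lemma maximal_subring_UNIV_iff:
  "maximal_subring V UNIV \<longleftrightarrow>
    is_subring V \<and> V \<noteq> UNIV \<and> (\<forall>W. is_subring W \<and> V \<subset> W \<longrightarrow> W = UNIV)"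
  unfolding maximal_subring_def by blast

lemma maximal_subring_omitting:
  assumes "maximal_subring_nonunit a V" "b \<notin> V"
  shows "max_omitting b V"
  using assms unfolding maximal_subring_nonunit_def maximal_subring_UNIV_iff max_omitting_def by blast

text \<open>The source of all maximal subrings for fields that are not absolutely algebraic. The ring \<open>A\<close> plays
the role of a discrete valuation ring with uniformizer \<open>a\<close> whose fraction field has \<open>E\<close> as an
algebraic extension. By the divisibility assumption, inverting \<open>a\<close> in a valuation ring above \<open>A\<close> inverts
all leading coefficients of algebraic equations over \<open>A\<close>, and hence yields all of \<open>E\<close>.\<close>
lemma ex_maximal_subring_nonunit:
  assumes A: "is_subring A" and a: "a \<in> A" "inverse a \<notin> A"
    and div: "\<And>c. c \<in> A \<Longrightarrow> c \<noteq> 0 \<Longrightarrow> \<exists>b\<in>A. \<exists>k. c * b = a ^ k"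
    and alg: "\<And>e. \<exists>f\<in>polys_over A. f \<noteq> 0 \<and> poly f e = 0"
  shows "\<exists>V. maximal_subring_nonunit a V"
proof -
  obtain V where V: "max_omitting (inverse a) V" "A \<subseteq> V" using ex_max_omitting[OF A a(2)] by blast
  then have sub: "is_subring V" and aV: "inverse a \<notin> V" by (auto simp: max_omitting_def)
  have a0: "a \<noteq> 0" using aV subringD(2)[OF sub] by auto
  have pow: "\<exists>k. a ^ k * e \<in> V" for e
  proof -
    obtain f where f: "f \<in> polys_over A" "f \<noteq> 0" "poly f e = 0" using alg by blast
    have fV: "f \<in> polys_over V" using f(1) polys_over_mono[OF V(2)] by blast
    have "Polynomial.lead_coeff f * e \<in> V"
      using lead_coeff_times_root_in[OF sub max_omitting_valuation[OF V(1)] fV f(2,3)] a V(2) by blast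
    moreover obtain b k where b: "b \<in> A" "Polynomial.lead_coeff f * b = a ^ k"
      using div[of "Polynomial.lead_coeff f"] f(1,2) polys_overD[OF f(1)] by auto
    ultimately have "b * (Polynomial.lead_coeff f * e) \<in> V" using V(2) by (auto simp: subringD[OF sub])
    then have "a ^ k * e \<in> V" using b(2) by (metis mult.assoc mult.commute)
    then show ?thesis by blast
  qed
  have "W = UNIV" if W: "is_subring W" "V \<subset> W" for W
  proof -
    have inv: "inverse a \<in> W" using V(1) W by (auto simp: max_omitting_def)
    have "e \<in> W" for e
    proof -
      obtain k where "a ^ k * e \<in> V" using pow by blast
      then have "a ^ k * e \<in> W" using W(2) by blast
      then have "inverse a ^ k * (a ^ k * e) \<in> W" by (rule subringD(4)[OF W(1) subringD(7)[OF W(1) inv]])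
      moreover have "inverse a ^ k * (a ^ k * e) = e" using a0 by (simp add: power_inverse)
      ultimately show ?thesis by simp
    qed
    then show ?thesis by blast
  qed
  then have "maximal_subring V UNIV" using sub aV by (auto simp: maximal_subring_UNIV_iff)
  then show ?thesis using a V(2) aV by (auto simp: maximal_subring_nonunit_def)
qed

section \<open>Maximal subrings of transcendental extensions\<close>

definition transcendental_over :: "'a::field set \<Rightarrow> 'a \<Rightarrow> bool"
  where "transcendental_over K x \<longleftrightarrow> (\<forall>f\<in>polys_over K. poly f x = 0 \<longrightarrow> f = 0)"

text \<open>The ring obtained is a substitute for a transcendence basis with \<open>x\<close> removed: \<open>E\<close> is algebraic
over \<open>K[x]\<close>, by the exchange property below.\<close>
lemma ex_max_transcendental:
  assumes K: "is_subring K0" "transcendental_over K0 x"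
  shows "\<exists>K. is_subring K \<and> transcendental_over K x \<and>
    (\<forall>W. is_subring W \<and> K \<subset> W \<longrightarrow> \<not> transcendental_over W x)"
proof -
  define \<A> where "\<A> = {W. is_subring W \<and> transcendental_over W x}"
  have "\<exists>M\<in>\<A>. \<forall>B\<in>\<A>. M \<subseteq> B \<longrightarrow> B = M"
  proof (rule subset_Zorn_nonempty)
    show "\<A> \<noteq> {}" using K by (auto simp: \<A>_def)
    fix \<C> assume \<C>: "\<C> \<noteq> {}" "subset.chain \<A> \<C>"
    then have C: "\<And>S. S \<in> \<C> \<Longrightarrow> S \<in> \<A>" by (auto simp: subset.chain_def)
    then have sub: "is_subring (\<Union>\<C>)"
      using is_subring_Union_chain[OF \<C>(1) _ \<C>(2)] by (auto simp: \<A>_def)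
    have "f = 0" if f: "f \<in> polys_over (\<Union>\<C>)" "poly f x = 0" for f
    proof -
      have fin: "\<exists>S\<in>\<C>. \<forall>i<n. poly.coeff f i \<in> S" for n
      proof (induction n)
        case (Suc n)
        then obtain S where S: "S \<in> \<C>" "\<forall>i<n. poly.coeff f i \<in> S" by blast
        obtain S' where S': "S' \<in> \<C>" "poly.coeff f n \<in> S'" using polys_overD[OF f(1)] by blast
        have "S \<subseteq> S' \<or> S' \<subseteq> S" using S(1) S'(1) \<C>(2) by (auto simp: subset.chain_def)
        then show ?case using S S' by (metis less_Suc_eq subsetD)
      qed (use \<C>(1) in auto)
      obtain S where S: "S \<in> \<C>" "\<forall>i<Suc (Polynomial.degree f). poly.coeff f i \<in> S"
        using fin by blast
      have "poly.coeff f i \<in> S" for i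
        using S(2) C[OF S(1)] by (cases "i \<le> Polynomial.degree f")
          (auto simp: \<A>_def coeff_eq_0 subringD)
      then have "f \<in> polys_over S" by (simp add: polys_over_def)
      then show ?thesis using C[OF S(1)] f(2) by (simp add: \<A>_def transcendental_over_def)
    qed
    then show "\<Union>\<C> \<in> \<A>" using sub by (simp add: \<A>_def transcendental_over_def)
  qed
  then obtain K where "K \<in> \<A>" "\<forall>B\<in>\<A>. K \<subseteq> B \<longrightarrow> B = K" by blast
  then show ?thesis unfolding \<A>_def by (intro exI[of _ K]) blast
qed

text \<open>The exchange property: a nontrivial polynomial relation between \<open>x\<close> and \<open>y\<close>, read as an equation for
\<open>x\<close> with coefficients in \<open>K[y]\<close>, is rearranged by powers of \<open>y\<close>. Transcendence of \<open>x\<close> keeps a nonzero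
coefficient nonzero.\<close>
lemma algebraic_swap:
  assumes K: "is_subring K" and x: "transcendental_over K x"
    and y: "\<not> transcendental_over (adjoin K y) x"
  shows "\<exists>h\<in>polys_over (adjoin K x). h \<noteq> 0 \<and> poly h y = 0"
proof -
  obtain f where f: "f \<in> polys_over (adjoin K y)" "f \<noteq> 0" "poly f x = 0"
    using y by (auto simp: transcendental_over_def)
  have "\<forall>j. \<exists>c. c \<in> polys_over K \<and> poly.coeff f j = poly c y"
    using f(1) by (fastforce simp: polys_over_def adjoin_def)
  then obtain c where c: "\<And>j. c j \<in> polys_over K" "\<And>j. poly.coeff f j = poly (c j) y" by metis
  define n where "n = Polynomial.degree f"
  define N where "N = Max ((\<lambda>j. Polynomial.degree (c j)) ` {..n})"
  have N: "Polynomial.degree (c j) \<le> N" if "j \<le> n" for j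
    unfolding N_def using that by (intro Max_ge) auto
  define r where "r i = (\<Sum>j\<le>n. monom (poly.coeff (c j) i) j)" for i
  have r: "r i \<in> polys_over K" for i
    unfolding r_def
    by (intro sum_in_polys_over[OF K] polys_over_closed(8)[OF K] polys_overD[OF c(1)])
  define h where "h = (\<Sum>i\<le>N. monom (poly (r i) x) i)"
  have "h \<in> polys_over (adjoin K x)"
    unfolding h_def using r
    by (intro sum_in_polys_over[OF is_subring_adjoin[OF K]]
        polys_over_closed(8)[OF is_subring_adjoin[OF K]]) (auto simp: adjoin_def)
  moreover have "poly h y = 0"
  proof -
    have "poly h y = (\<Sum>i\<le>N. (\<Sum>j\<le>n. poly.coeff (c j) i * x ^ j) * y ^ i)"
      by (simp add: h_def r_def poly_sum poly_monom)
    also have "\<dots> = (\<Sum>i\<le>N. \<Sum>j\<le>n. poly.coeff (c j) i * x ^ j * y ^ i)"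
      by (simp add: sum_distrib_right)
    also have "\<dots> = (\<Sum>j\<le>n. \<Sum>i\<le>N. poly.coeff (c j) i * x ^ j * y ^ i)" by (rule sum.swap)
    also have "\<dots> = (\<Sum>j\<le>n. poly.coeff f j * x ^ j)"
    proof (rule sum.cong)
      fix j assume j: "j \<in> {..n}"
      have "poly (c j) y = (\<Sum>i\<le>N. poly.coeff (c j) i * y ^ i)"
        unfolding poly_altdef using N[of j] j
        by (intro sum.mono_neutral_left) (auto simp: coeff_eq_0)
      then show "(\<Sum>i\<le>N. poly.coeff (c j) i * x ^ j * y ^ i) = poly.coeff f j * x ^ j"
        by (simp add: c(2) sum_distrib_left sum_distrib_right mult_ac)
    qed simp
    also have "\<dots> = poly f x" by (simp add: poly_altdef n_def)
    finally show ?thesis using f(3) by simp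
  qed
  moreover have "h \<noteq> 0"
  proof -
    have "poly (c n) y \<noteq> 0" using c(2)[of n] f(2) by (metis n_def leading_coeff_0_iff)
    then have "c n \<noteq> 0" by auto
    define i where "i = Polynomial.degree (c n)"
    have i: "poly.coeff (c n) i \<noteq> 0" using \<open>c n \<noteq> 0\<close> by (simp add: i_def)
    have "poly.coeff (r i) n = poly.coeff (c n) i"
      by (simp add: r_def coeff_sum if_distrib cong: if_cong)
    then have "r i \<noteq> 0" using i by auto
    then have "poly (r i) x \<noteq> 0" using x r by (auto simp: transcendental_over_def)
    moreover have "poly.coeff h i = poly (r i) x"
      using N[of n] by (simp add: h_def coeff_sum if_distrib i_def cong: if_cong)
    ultimately show ?thesis by auto
  qed
  ultimately show ?thesis by blast
qed

text \<open>The base ring is \<open>K[x]\<close> localized at \<open>x\<close>, for a ring \<open>K\<close> that is maximal with \<open>x\<close> transcendental over it.\<close>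
lemma maximal_subring_nonunit_transcendental:
  assumes "transcendental_over (range of_int) (x :: 'a::field)"
  shows "\<exists>V. maximal_subring_nonunit x V"
proof -
  obtain K where K: "is_subring K" and x: "transcendental_over K x"
    and max: "\<And>W. is_subring W \<Longrightarrow> K \<subset> W \<Longrightarrow> \<not> transcendental_over W x"
    using ex_max_transcendental[OF is_subring_prime_ring assms] by blast
  note Kp = polys_over_closed[OF K]
  have nz: "poly f x \<noteq> 0" if "f \<in> polys_over K" "f \<noteq> 0" for f
    using that x by (auto simp: transcendental_over_def)
  \<comment> \<open>The condition on \<open>g\<close> says \<open>g(0) \<noteq> 0\<close>; only polynomials that are divisible by \<open>x\<close> lack an inverse in \<open>A\<close>.\<close>
  define A where "A = {poly f x / poly g x | f g. f \<in> polys_over K \<and> g \<in> polys_over K \<and> poly.coeff g 0 \<noteq> 0}"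
  have AI: "poly f x / poly g x \<in> A" if "f \<in> polys_over K" "g \<in> polys_over K" "poly.coeff g 0 \<noteq> 0" for f g
    using that by (auto simp: A_def)
  have polyA: "poly f x \<in> A" if "f \<in> polys_over K" for f
    using AI[OF that Kp(2)] by simp
  have sub: "is_subring A"
    unfolding is_subring_iff
  proof (intro conjI ballI)
    show "1 \<in> A" using polyA[OF Kp(2)] by simp
    fix y z assume "y \<in> A" "z \<in> A"
    then obtain f g f' g' where y: "y = poly f x / poly g x" and z: "z = poly f' x / poly g' x"
      and fg: "f \<in> polys_over K" "g \<in> polys_over K" "f' \<in> polys_over K" "g' \<in> polys_over K"
        "poly.coeff g 0 \<noteq> 0" "poly.coeff g' 0 \<noteq> 0" by (auto simp: A_def)
    have g0: "poly g x \<noteq> 0" "poly g' x \<noteq> 0" by (rule nz; use fg in auto)+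
    have gg: "g * g' \<in> polys_over K" "poly.coeff (g * g') 0 \<noteq> 0"
      using fg by (auto simp: Kp coeff_mult)
    have "y - z = poly (f * g' - f' * g) x / poly (g * g') x"
      using g0 by (simp add: y z field_simps)
    then show "y - z \<in> A" using AI[OF _ gg, of "f * g' - f' * g"] fg by (simp add: Kp)
    have "y * z = poly (f * f') x / poly (g * g') x" by (simp add: y z)
    then show "y * z \<in> A" using AI[OF _ gg, of "f * f'"] fg by (simp add: Kp)
  qed
  have "[:0, 1:] \<in> polys_over K" by (intro Kp subringD[OF K])
  then have xA: "x \<in> A" using polyA by fastforce
  have x0: "x \<noteq> 0" using nz[OF \<open>[:0, 1:] \<in> polys_over K\<close>] by auto
  have "inverse x \<notin> A"
  proof
    assume "inverse x \<in> A"
    then obtain f g where fg: "inverse x = poly f x / poly g x" "f \<in> polys_over K"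
      "g \<in> polys_over K" "poly.coeff g 0 \<noteq> 0" by (auto simp: A_def)
    have "poly g x \<noteq> 0" by (rule nz) (use fg in auto)
    then have "poly (g - pCons 0 f) x = 0" using fg(1) x0 by (simp add: field_simps)
    moreover have "g - pCons 0 f \<in> polys_over K" using fg by (intro Kp subringD[OF K])
    ultimately have "g = pCons 0 f" using nz by fastforce
    then show False using fg(4) by simp
  qed
  moreover have "\<exists>b\<in>A. \<exists>k. c * b = x ^ k" if c: "c \<in> A" "c \<noteq> 0" for c
  proof -
    obtain f g where fg: "c = poly f x / poly g x" "f \<in> polys_over K"
      "g \<in> polys_over K" "poly.coeff g 0 \<noteq> 0" using c(1) by (auto simp: A_def)
    have "poly f x \<noteq> 0" "poly g x \<noteq> 0" using c(2) fg(1) by auto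
    then have "f \<noteq> 0" by auto
    \<comment> \<open>Write \<open>f = X^k f'\<close> with \<open>f'(0) \<noteq> 0\<close>.\<close>
    define k where "k = (LEAST i. poly.coeff f i \<noteq> 0)"
    have "\<exists>i. poly.coeff f i \<noteq> 0" using \<open>f \<noteq> 0\<close> by (simp add: poly_eq_iff)
    then have k: "poly.coeff f k \<noteq> 0" unfolding k_def by (rule LeastI_ex)
    have below: "poly.coeff f i = 0" if "i < k" for i using not_less_Least that unfolding k_def by blast
    define f' where "f' = poly_shift k f"
    have f': "f = monom 1 k * f'"
      using below by (intro poly_eqI) (auto simp: f'_def coeff_monom_mult coeff_poly_shift)
    have f'K: "f' \<in> polys_over K" using fg(2) by (auto simp: f'_def polys_over_def coeff_poly_shift)
    have f'0: "poly.coeff f' 0 \<noteq> 0" using k by (simp add: f'_def coeff_poly_shift)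
    have "poly g x / poly f' x \<in> A" by (rule AI[OF fg(3) f'K f'0])
    moreover have "c * (poly g x / poly f' x) = x ^ k"
      using \<open>poly f x \<noteq> 0\<close> \<open>poly g x \<noteq> 0\<close> by (simp add: fg(1) f' poly_monom)
    ultimately show ?thesis by blast
  qed
  moreover have "\<exists>f\<in>polys_over A. f \<noteq> 0 \<and> poly f e = 0" for e
  proof (cases "e \<in> K")
    case True
    then have "[:-e, 1:] \<in> polys_over K" by (intro Kp subringD[OF K])
    moreover have "polys_over K \<subseteq> polys_over A"
    proof (rule polys_over_mono, rule)
      fix a assume "a \<in> K"
      then have "[:a:] \<in> polys_over K" by (intro Kp)
      then show "a \<in> A" using polyA by fastforce
    qed
    ultimately show ?thesis by (intro bexI[of _ "[:-e, 1:]"]) auto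
  next
    case False
    then have "K \<subset> adjoin K e" using subset_adjoin[OF K, of e] by blast
    then have "\<not> transcendental_over (adjoin K e) x" using max is_subring_adjoin[OF K] by blast
    then obtain h where h: "h \<in> polys_over (adjoin K x)" "h \<noteq> 0" "poly h e = 0"
      using algebraic_swap[OF K x] by blast
    have "polys_over (adjoin K x) \<subseteq> polys_over A"
      by (rule polys_over_mono) (auto simp: adjoin_def polyA)
    then show ?thesis using h by blast
  qed
  ultimately show ?thesis using ex_maximal_subring_nonunit[OF sub xA] by blast
qed

section \<open>Intersections of independent maximal subrings\<close>

text \<open>Since \<open>V\<close> is maximal, \<open>V[1/a]\<close> is the whole field.\<close>
lemma maximal_subring_nonunit_pow:
  assumes V: "maximal_subring_nonunit a V"
  shows "\<exists>k. a ^ k * e \<in> V"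
proof -
  have sub: "is_subring V" and a: "a \<in> V" "inverse a \<notin> V"
    and max: "\<And>W. is_subring W \<Longrightarrow> V \<subset> W \<Longrightarrow> W = UNIV"
    using V by (auto simp: maximal_subring_nonunit_def maximal_subring_UNIV_iff)
  have a0: "a \<noteq> 0" using a(2) subringD(2)[OF sub] by auto
  have "V \<subset> adjoin V (inverse a)" using subset_adjoin[OF sub, of "inverse a"] a(2) by blast
  then have "adjoin V (inverse a) = UNIV" by (rule max[OF is_subring_adjoin[OF sub]])
  then have "e \<in> adjoin V (inverse a)" by blast
  then obtain f where f: "f \<in> polys_over V" "e = poly f (inverse a)" by (auto simp: adjoin_def)
  have "reflect_poly f \<in> polys_over V"
    using f(1) subringD(2)[OF sub] by (auto simp: polys_over_def coeff_reflect_poly)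
  then have "poly (reflect_poly f) a \<in> V" by (rule poly_in_subring[OF sub _ a(1)])
  then have "a ^ Polynomial.degree f * e \<in> V" using a0 f(2) by (simp add: poly_reflect_poly_nz)
  then show ?thesis by blast
qed

lemma maximal_subring_nonunit_mult:
  assumes V: "maximal_subring_nonunit a V" and "b \<in> V" "b \<noteq> 0"
  shows "maximal_subring_nonunit (a * b) V"
proof -
  have sub: "is_subring V" and a: "a \<in> V" "inverse a \<notin> V"
    using maximal_subring_nonunitD[OF V] by blast+
  have "inverse (a * b) \<notin> V"
  proof
    assume "inverse (a * b) \<in> V"
    then have "b * inverse (a * b) \<in> V" by (rule subringD(4)[OF sub assms(2)])
    moreover have "b * inverse (a * b) = inverse a" using assms(3) by (simp add: field_simps)
    ultimately show False using a(2) by metis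
  qed
  then show ?thesis using V subringD(4)[OF sub a(1) assms(2)] by (simp add: maximal_subring_nonunit_def)
qed

text \<open>The maximal subring \<open>V\<close> is local: after division by \<open>u\<close>, the sum is \<open>1\<close> plus a multiple of \<open>c\<close>.\<close>
lemma unit_plus_nonunit:
  assumes c: "maximal_subring_nonunit c V" and u: "u \<in> V" "inverse u \<in> V" "u \<noteq> 0"
  shows "u + c \<noteq> 0" and "inverse (u + c) \<in> V"
proof -
  have sub: "is_subring V" and cV: "c \<in> V" "inverse c \<notin> V"
    using maximal_subring_nonunitD[OF c] by blast+
  show "u + c \<noteq> 0"
  proof
    assume "u + c = 0"
    then have "c = - u" by (simp add: eq_neg_iff_add_eq_0 add.commute)
    then show False using cV u subringD(5)[OF sub u(2)] by simp
  qed
  have "inverse (1 - c * (- inverse u)) \<in> V"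
    by (rule inverse_one_minus_in[OF maximal_subring_omitting[OF c cV(2)] cV(1)
          subringD(5)[OF sub u(2)]])
  then have "inverse u * inverse (1 - c * (- inverse u)) \<in> V" by (rule subringD(4)[OF sub u(2)])
  moreover have "u * (1 - c * (- inverse u)) = u + c" using u(3) by (simp add: field_simps)
  ultimately show "inverse (u + c) \<in> V" by (metis inverse_mult_distrib)
qed

text \<open>The \<open>V i\<close> are valuation rings of rank one, and \<open>a j\<close> has positive value for the
valuation of \<open>V j\<close> and value zero for the others.\<close>
definition independent_subrings :: "(nat \<Rightarrow> 'a::field) \<Rightarrow> (nat \<Rightarrow> 'a set) \<Rightarrow> bool"
  where "independent_subrings a V \<longleftrightarrow> (\<forall>i. maximal_subring_nonunit (a i) (V i) \<and>
    (\<forall>j. a j \<in> V i \<and> (j \<noteq> i \<longrightarrow> inverse (a j) \<in> V i)))"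

lemma infinite_maximal_subrings_if_independent:
  assumes "independent_subrings (a :: nat \<Rightarrow> 'a::field) V"
  shows "infinite {S :: 'a set. maximal_subring S UNIV}"
proof -
  have V: "maximal_subring_nonunit (a i) (V i)" "j \<noteq> i \<Longrightarrow> inverse (a j) \<in> V i" for i j
    using assms unfolding independent_subrings_def by blast+
  have "inj V"
  proof (rule injI, rule ccontr)
    fix i j assume "V i = V j" "i \<noteq> j"
    then show False using V(2)[of i j] maximal_subring_nonunitD(3)[OF V(1)[of i]] by simp
  qed
  then have inf: "infinite (range V)" by (rule range_inj_infinite)
  have "range V \<subseteq> {S. maximal_subring S UNIV}"
    using V(1) unfolding maximal_subring_nonunit_def by blast
  then show ?thesis by (rule infinite_super[OF _ inf])
qed

context
  fixes a :: "nat \<Rightarrow> 'a::field" and V :: "nat \<Rightarrow> 'a set"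
  assumes ind: "independent_subrings a V"
begin

lemma ind_nonunit: "maximal_subring_nonunit (a i) (V i)"
  and ind_in: "a j \<in> V i"
  and ind_inverse: "j \<noteq> i \<Longrightarrow> inverse (a j) \<in> V i"
  and ind_not: "inverse (a i) \<notin> V i"
  and ind_subring: "is_subring (V i)"
proof -
  show "maximal_subring_nonunit (a i) (V i)" "a j \<in> V i" "j \<noteq> i \<Longrightarrow> inverse (a j) \<in> V i" for i j
    using ind unfolding independent_subrings_def by blast+
  then show "inverse (a i) \<notin> V i" "is_subring (V i)" for i
    using maximal_subring_nonunitD by blast+
qed

lemma ind_nz: "a i \<noteq> 0"
  using ind_not[of i] subringD(2)[OF ind_subring, of i] by auto

lemma is_subring_INT: "is_subring (\<Inter>i<n. V i)"
proof (cases "n = 0")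
  case False
  then show ?thesis by (intro is_subring_Inter) (auto intro: ind_subring)
qed (simp add: is_subring_UNIV)

text \<open>An element of \<open>V n\<close> is approximated to any precision by an element that lies in the earlier rings too.
Multiplication by \<open>u = x^k / (x^k + t)\<close> does this, where \<open>t = a n ^ N\<close> is the precision and \<open>x\<close> is the
product of the \<open>a i\<close> with \<open>i < n\<close>: \<open>u\<close> is \<open>1\<close> modulo \<open>t\<close> in \<open>V n\<close>, and it is divisible in \<open>V i\<close> by a power
of \<open>a i\<close> high enough to cancel the denominator of \<open>v\<close>.\<close>
lemma weak_approximation:
  assumes v: "v \<in> V n" and N: "N > 0"
  shows "\<exists>b\<in>(\<Inter>i<Suc n. V i). \<exists>w\<in>V n. v - b = a n ^ N * w"
proof -
  define x where "x = (\<Prod>i<n. a i)"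
  define t where "t = a n ^ N"
  have "\<exists>k. a i ^ k * v \<in> V i" for i by (rule maximal_subring_nonunit_pow[OF ind_nonunit])
  then obtain K where K: "\<And>i. a i ^ K i * v \<in> V i" by metis
  \<comment> \<open>A common exponent for all \<open>i < n\<close>; it is positive so that \<open>x ^ k\<close> is a nonunit in these rings.\<close>
  define k where "k = Suc (\<Sum>i<n. K i)"
  have x0: "x \<noteq> 0" by (simp add: x_def ind_nz)
  have xV: "x \<in> V i" for i unfolding x_def by (intro subring_prod[OF ind_subring] ind_in)
  have x_split: "\<exists>y\<in>V i. x = a i * y" if "i < n" for i
  proof
    show "x = a i * (\<Prod>j\<in>{..<n} - {i}. a j)" unfolding x_def using that by (simp add: prod.remove)
    show "(\<Prod>j\<in>{..<n} - {i}. a j) \<in> V i" by (intro subring_prod[OF ind_subring] ind_in)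
  qed
  have "inverse x = (\<Prod>i<n. inverse (a i))" unfolding x_def by (induction n) simp_all
  also have "\<dots> \<in> V n" by (intro subring_prod[OF ind_subring] ind_inverse) auto
  finally have inv_x: "inverse x \<in> V n" .
  have t0: "t \<noteq> 0" by (simp add: t_def ind_nz)
  have tV: "t \<in> V i" for i unfolding t_def by (intro subringD(7)[OF ind_subring] ind_in)
  have inv: "x ^ k + t \<noteq> 0 \<and> inverse (x ^ k + t) \<in> V i" if "i \<le> n" for i
  proof (cases "i = n")
    case True
    have "t = a n * a n ^ (N - 1)" using N by (simp add: t_def power_eq_if)
    then have "maximal_subring_nonunit t (V n)"
      using maximal_subring_nonunit_mult[OF ind_nonunit, of "a n ^ (N - 1)" n]
        subringD(7)[OF ind_subring ind_in] by (simp add: ind_nz)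
    moreover have "x ^ k \<in> V n" "inverse (x ^ k) \<in> V n"
      using subringD(7)[OF ind_subring xV] subringD(7)[OF ind_subring inv_x]
      by (simp_all add: power_inverse)
    ultimately show ?thesis using unit_plus_nonunit[of t "V n" "x ^ k"] x0 True by simp
  next
    case False
    with that have i: "i < n" by simp
    obtain y where y: "y \<in> V i" "x = a i * y" using x_split[OF i] by blast
    have "x ^ k = a i * (y * x ^ (k - 1))" by (simp add: k_def y(2))
    moreover have "y * x ^ (k - 1) \<in> V i"
      by (rule subringD(4)[OF ind_subring y(1) subringD(7)[OF ind_subring xV]])
    moreover have "y * x ^ (k - 1) \<noteq> 0" using x0 y(2) by auto
    ultimately have "maximal_subring_nonunit (x ^ k) (V i)"
      using maximal_subring_nonunit_mult[OF ind_nonunit, of "y * x ^ (k - 1)" i] by simp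
    moreover have "inverse t \<in> V i"
      unfolding t_def power_inverse[symmetric]
      by (rule subringD(7)[OF ind_subring ind_inverse]) (use i in auto)
    ultimately show ?thesis
      using unit_plus_nonunit[of "x ^ k" "V i" t] t0 tV by (simp add: add.commute)
  qed
  define b where "b = (x ^ k * v) * inverse (x ^ k + t)"
  have "b \<in> V i" if "i < Suc n" for i
  proof -
    have "x ^ k * v \<in> V i"
    proof (cases "i = n")
      case True
      then show ?thesis using subringD(4)[OF ind_subring subringD(7)[OF ind_subring xV] v] by simp
    next
      case False
      with that have i: "i < n" by simp
      obtain y where y: "y \<in> V i" "x = a i * y" using x_split[OF i] by blast
      have "K i \<le> k" using i member_le_sum[of i "{..<n}" K] by (simp add: k_def)
      then have "a i ^ k = a i ^ (k - K i) * a i ^ K i" by (simp flip: power_add)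
      then have "x ^ k * v = (y ^ k * a i ^ (k - K i)) * (a i ^ K i * v)"
        by (simp add: y(2) power_mult_distrib mult_ac)
      also have "\<dots> \<in> V i"
        by (rule subringD(4)[OF ind_subring subringD(4)[OF ind_subring
              subringD(7)[OF ind_subring y(1)] subringD(7)[OF ind_subring ind_in]] K])
      finally show ?thesis .
    qed
    moreover have "inverse (x ^ k + t) \<in> V i" using inv[of i] that by simp
    ultimately show ?thesis unfolding b_def by (rule subringD(4)[OF ind_subring])
  qed
  then have "b \<in> (\<Inter>i<Suc n. V i)" by blast
  moreover have "v - b = t * (v * inverse (x ^ k + t))"
    using inv[of n] by (simp add: b_def field_simps)
  moreover have "v * inverse (x ^ k + t) \<in> V n"
    by (rule subringD(4)[OF ind_subring v]) (use inv[of n] in simp)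
  ultimately show ?thesis unfolding t_def by blast
qed

text \<open>An intermediate ring \<open>W\<close> has an element \<open>e\<close> outside \<open>V n\<close>, so that \<open>1 / a n\<close> is a polynomial in \<open>e\<close> over
\<open>V n\<close>. Its coefficients can be replaced by elements of the smaller intersection at the cost of an error in
\<open>V n\<close>. Hence \<open>W\<close> contains \<open>1 / a n\<close>, and powers of \<open>a n\<close> carry the larger intersection into the smaller.\<close>
lemma maximal_subring_INT:
  "maximal_subring (\<Inter>i<Suc n. V i) (\<Inter>i<n. V i)"
proof -
  let ?B = "\<Inter>i<Suc n. V i" and ?R = "\<Inter>i<n. V i"
  have "inverse (a n) \<in> ?R" using ind_inverse by auto
  then have psub: "?B \<subset> ?R" using ind_not[of n] by (auto simp: lessThan_Suc)
  have "W = ?B" if W: "is_subring W" "W \<subset> ?R" "?B \<subseteq> W" for W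
  proof (rule ccontr)
    assume "W \<noteq> ?B"
    then obtain e where e: "e \<in> W" "e \<notin> ?B" using W(3) by blast
    then have eR: "e \<in> V i" if "i < n" for i using that W(2) by blast
    have en: "e \<notin> V n" using e eR by (auto simp: less_Suc_eq)
    have "V n \<subset> adjoin (V n) e" using subset_adjoin[OF ind_subring[of n], of e] en by blast
    then have "adjoin (V n) e = UNIV"
      using ind_nonunit[of n] is_subring_adjoin[OF ind_subring[of n]]
      by (auto simp: maximal_subring_nonunit_def maximal_subring_UNIV_iff)
    then have "inverse (a n) \<in> adjoin (V n) e" by blast
    then obtain f where f: "f \<in> polys_over (V n)" "inverse (a n) = poly f e"
      by (auto simp: adjoin_def)
    define d where "d = Polynomial.degree f"
    obtain K where K: "a n ^ K * e \<in> V n" using maximal_subring_nonunit_pow[OF ind_nonunit] by blast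
    \<comment> \<open>The precision that makes an error in the coefficient of \<open>e ^ i\<close> harmless for all \<open>i \<le> d\<close>.\<close>
    define N where "N = Suc (K * d)"
    have small: "a n ^ N * e ^ i \<in> V n" if "i \<le> d" for i
    proof -
      have "K * i \<le> N" unfolding N_def using mult_le_mono2[OF that, of K] by linarith
      then have "a n ^ N = a n ^ (N - K * i) * a n ^ (K * i)" by (simp flip: power_add)
      then have "a n ^ N * e ^ i = a n ^ (N - K * i) * (a n ^ K * e) ^ i"
        by (simp add: power_mult_distrib power_mult)
      also have "\<dots> \<in> V n"
        by (rule subringD(4)[OF ind_subring subringD(7)[OF ind_subring ind_in] subringD(7)[OF ind_subring K]])
      finally show ?thesis .
    qed
    have "\<exists>b w. b \<in> ?B \<and> w \<in> V n \<and> poly.coeff f i - b = a n ^ N * w" for i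
      using weak_approximation[OF polys_overD[OF f(1), of i], of N] by (auto simp: N_def)
    then obtain b w where bw: "\<And>i. b i \<in> ?B" "\<And>i. w i \<in> V n"
      "\<And>i. poly.coeff f i - b i = a n ^ N * w i" by metis
    define s where "s = (\<Sum>i\<le>d. b i * e ^ i)"
    have "inverse (a n) - s = (\<Sum>i\<le>d. (poly.coeff f i - b i) * e ^ i)"
      by (simp add: f(2) poly_altdef d_def s_def sum_subtractf left_diff_distrib)
    also have "\<dots> = (\<Sum>i\<le>d. w i * (a n ^ N * e ^ i))" by (simp add: bw(3) mult_ac)
    also have "\<dots> \<in> V n"
      by (rule subring_sum[OF ind_subring]) (rule subringD(4)[OF ind_subring bw(2) small], simp)
    finally have "inverse (a n) - s \<in> V n" .
    moreover have "inverse (a n) - s \<in> V i" if "i < n" for i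
    proof (rule subringD(3)[OF ind_subring])
      show "inverse (a n) \<in> V i" using ind_inverse that by auto
      have "b j \<in> V i" for j using bw(1)[of j] that by (auto simp: less_Suc_eq)
      then show "s \<in> V i" unfolding s_def
        by (intro subring_sum[OF ind_subring]
            subringD(4)[OF ind_subring _ subringD(7)[OF ind_subring eR[OF that]]])
    qed
    ultimately have "inverse (a n) - s \<in> ?B" by (auto simp: less_Suc_eq)
    then have "inverse (a n) - s \<in> W" using W(3) by blast
    moreover have "s \<in> W"
      unfolding s_def
    proof (rule subring_sum[OF W(1)])
      fix i show "b i * e ^ i \<in> W"
        by (rule subringD(4)[OF W(1) subsetD[OF W(3) bw(1)] subringD(7)[OF W(1) e(1)]])
    qed
    ultimately have "(inverse (a n) - s) + s \<in> W" by (rule subringD(6)[OF W(1)])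
    then have inv: "inverse (a n) \<in> W" by simp
    have "y \<in> W" if y: "y \<in> ?R" for y
    proof -
      obtain k where k: "a n ^ k * y \<in> V n" using maximal_subring_nonunit_pow[OF ind_nonunit] by blast
      have "a n ^ k * y \<in> V i" if "i < n" for i
        by (rule subringD(4)[OF ind_subring subringD(7)[OF ind_subring ind_in]]) (use y that in blast)
      with k have "a n ^ k * y \<in> ?B" by (auto simp: less_Suc_eq)
      then have "a n ^ k * y \<in> W" using W(3) by blast
      then have "inverse (a n) ^ k * (a n ^ k * y) \<in> W"
        by (rule subringD(4)[OF W(1) subringD(7)[OF W(1) inv]])
      moreover have "inverse (a n) ^ k * (a n ^ k * y) = y" using ind_nz[of n] by (simp add: power_inverse)
      ultimately show ?thesis by simp
    qed
    then show False using W(2) by blast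
  qed
  then show ?thesis
    unfolding maximal_subring_def by (intro conjI allI impI is_subring_INT psub) simp
qed

lemma infinite_chain_if_independent:
  "infinite_maximal_subring_chain (\<lambda>n. \<Inter>i<n. V i)"
  unfolding infinite_maximal_subring_chain_def
  by (intro conjI allI maximal_subring_INT) simp

end

section \<open>Independent maximal subrings outside the absolutely algebraic case\<close>

text \<open>For \<open>s = 2\<close> this is Sylvester's sequence 2, 3, 7, 43, \<open>\<dots>\<close>. The later of two terms is \<open>1\<close> plus a multiple
of the earlier one, which makes them comaximal, and every term is integral over the ring generated by a
later one. So a single element \<open>s\<close> provides all the nonunits that independent subrings require.\<close>
primrec sylvester :: "'a::field \<Rightarrow> nat \<Rightarrow> 'a"
  where "sylvester s 0 = s"
  | "sylvester s (Suc n) = 1 - sylvester s n + sylvester s n ^ 2"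

lemma sylvester_mod:
  assumes V: "is_subring V" "\<And>j. sylvester s j \<in> V"
  shows "i < j \<Longrightarrow> \<exists>y\<in>V. sylvester s j = 1 + sylvester s i * y"
proof (induction j)
  case (Suc j)
  have *: "sylvester s (Suc j) = 1 + sylvester s j * (sylvester s j - 1)"
    by (simp add: power2_eq_square algebra_simps)
  have m1: "sylvester s j - 1 \<in> V" by (rule subringD(3)[OF V(1) V(2) subringD(1)[OF V(1)]])
  show ?case
  proof (cases "i = j")
    case True
    then show ?thesis using * m1 by blast
  next
    case False
    then obtain y where y: "y \<in> V" "sylvester s j = 1 + sylvester s i * y" using Suc by auto
    have "sylvester s (Suc j) = 1 + sylvester s i * (y * sylvester s j)"
      unfolding * using y(2) by (simp add: algebra_simps)
    then show ?thesis using subringD(4)[OF V(1) y(1) V(2)] by blast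
  qed
qed simp

text \<open>Going up, the terms are polynomials in earlier ones. Going down, \<open>t = sylvester s n\<close> is a root of the
monic equation \<open>t\<^sup>2 - t + 1 - sylvester s (n + 1) = 0\<close>, and valuation rings are integrally closed.\<close>
lemma sylvester_in:
  assumes V: "is_subring V" "\<And>t. t \<in> V \<or> inverse t \<in> V" and i: "sylvester s i \<in> V"
  shows "sylvester s j \<in> V"
proof -
  have down: "sylvester s n \<in> V" if n: "sylvester s (Suc n) \<in> V" for n
  proof (rule ccontr)
    assume out: "sylvester s n \<notin> V"
    define t where "t = sylvester s n"
    define c where "c = sylvester s (Suc n)"
    have t: "inverse t \<in> V" "t \<noteq> 0" using out V(2)[of t] subringD(2)[OF V(1)] by (auto simp: t_def)
    have "t = 1 + (c - 1) * inverse t" using t(2) by (simp add: c_def t_def power2_eq_square field_simps)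
    also have "\<dots> \<in> V" using n by (intro subringD[OF V(1)] t) (simp add: c_def)
    finally show False using out by (simp add: t_def)
  qed
  have "sylvester s 0 \<in> V" using i by (induction i) (use down in blast)+
  then show ?thesis by (induction j) (auto simp: subringD[OF V(1)])
qed

text \<open>Let \<open>V i\<close> have the nonunit \<open>s\<^sub>i\<close>. A later term is \<open>1 + s\<^sub>i y\<close>, a unit in a local ring. An earlier term
\<open>s\<^sub>j\<close> divides \<open>s\<^sub>i - 1\<close>, which is a unit as well.\<close>
lemma ex_independent_subrings:
  assumes "\<And>n. \<exists>V. maximal_subring_nonunit (sylvester s n) V"
  shows "\<exists>V. independent_subrings (sylvester s) V"
proof -
  obtain V where V: "\<And>n. maximal_subring_nonunit (sylvester s n) (V n)" using assms by metis
  have "inverse (sylvester s j) \<in> V i \<and> sylvester s k \<in> V i" if "j \<noteq> i" for i j k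
  proof -
    have sub: "is_subring (V i)" and si: "sylvester s i \<in> V i" "inverse (sylvester s i) \<notin> V i"
      using maximal_subring_nonunitD[OF V] by blast+
    note om = maximal_subring_omitting[OF V si(2)]
    have all: "sylvester s j \<in> V i" for j
      by (rule sylvester_in[OF sub max_omitting_valuation[OF om si(1)] si(1)])
    note unit = inverse_one_minus_in[OF om si(1)]
    have "inverse (sylvester s j) \<in> V i"
    proof (cases "i < j")
      case True
      then obtain y where y: "y \<in> V i" "sylvester s j = 1 + sylvester s i * y"
        using sylvester_mod[OF sub all] by blast
      then show ?thesis using unit[OF subringD(5)[OF sub y(1)]] by simp
    next
      case False
      with that have "j < i" by simp
      then obtain y where y: "y \<in> V i" "sylvester s i = 1 + sylvester s j * y"
        using sylvester_mod[OF sub all] by blast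
      have "inverse (1 - sylvester s i) \<in> V i" using unit[OF subringD(1)[OF sub]] by simp
      then have "- y * inverse (1 - sylvester s i) \<in> V i"
        by (rule subringD(4)[OF sub subringD(5)[OF sub y(1)]])
      moreover have "1 - sylvester s i \<noteq> 0"
      proof
        assume "1 - sylvester s i = 0"
        then show False using si subringD(1)[OF sub] by simp
      qed
      then have "- y * inverse (1 - sylvester s i) = inverse (sylvester s j)"
        using y(2) by (simp add: field_simps)
      ultimately show ?thesis by simp
    qed
    then show ?thesis using all by blast
  qed
  then have "independent_subrings (sylvester s) V"
    using V unfolding independent_subrings_def by (metis n_not_Suc_n)
  then show ?thesis by blast
qed

text \<open>An equation for \<open>1 - t + t\<^sup>2\<close> is one for \<open>t\<close>, and composition with a nonconstant polynomial is injective.\<close>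
lemma transcendental_sylvester:
  assumes "transcendental_over (range of_int) s"
  shows "transcendental_over (range of_int) (sylvester s n)"
proof (induction n)
  case (Suc n)
  let ?q = "[:1, -1, 1:] :: 'a poly"
  have q: "?q \<in> polys_over (range of_int)"
    by (intro polys_over_closed[OF is_subring_prime_ring] subringD[OF is_subring_prime_ring])
  have "f = 0" if f: "f \<in> polys_over (range of_int)" "poly f (sylvester s (Suc n)) = 0" for f
  proof -
    have "poly (pcompose f ?q) (sylvester s n) = 0"
      using f(2) by (simp add: poly_pcompose power2_eq_square algebra_simps)
    then have "pcompose f ?q = 0"
      using Suc pcompose_in_polys_over[OF is_subring_prime_ring q f(1)]
      by (auto simp: transcendental_over_def)
    then show "f = 0" by (simp add: pcompose_eq_0_iff)
  qed
  then show ?case by (auto simp: transcendental_over_def)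
qed (use assms in simp)

text \<open>The base ring is \<open>\<int>\<close> localized at a prime divisor \<open>p\<close> of \<open>n\<close>. A ring without \<open>1/p\<close> does not contain
\<open>1/n\<close> either.\<close>
lemma maximal_subring_nonunit_of_nat:
  assumes char: "CHAR('a::field) = 0" and alg: "\<And>e::'a. \<not> transcendental_over (range of_int) e"
    and n: "n > 1"
  shows "\<exists>V. maximal_subring_nonunit (of_nat n :: 'a) V"
proof -
  have eq: "(of_int x :: 'a) = of_int y \<longleftrightarrow> x = y" for x y
    by (simp add: of_int_eq_iff_cong_CHAR char cong_def)
  have eq0: "(of_int x :: 'a) = 0 \<longleftrightarrow> x = 0" for x using eq[of x 0] by simp
  obtain p where p: "prime p" "p dvd n" using n prime_factor_nat by (metis less_irrefl)
  define q where "q = int p"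
  have q: "prime q" using p(1) by (simp add: q_def)
  define A where "A = {of_int x / of_int y :: 'a | x y. \<not> q dvd y}"
  have AI: "of_int x / of_int y \<in> A" if "\<not> q dvd y" for x y using that by (auto simp: A_def)
  have intA: "of_int x \<in> A" for x
    using AI[of 1 x] q by (auto dest: not_prime_unit)
  have sub: "is_subring A"
    unfolding is_subring_iff
  proof (intro conjI ballI)
    show "1 \<in> A" using intA[of 1] by simp
    fix v w assume "v \<in> A" "w \<in> A"
    then obtain x y x' y' where v: "v = of_int x / of_int y" "\<not> q dvd y"
      and w: "w = of_int x' / of_int y'" "\<not> q dvd y'" by (auto simp: A_def)
    have yy: "\<not> q dvd y * y'" using v(2) w(2) q by (simp add: prime_dvd_mult_iff)
    have "y \<noteq> 0" "y' \<noteq> 0" using v(2) w(2) by auto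
    then have "v - w = of_int (x * y' - x' * y) / of_int (y * y')" "v * w = of_int (x * x') / of_int (y * y')"
      by (simp_all add: v w eq0 field_simps)
    then show "v - w \<in> A" "v * w \<in> A" using AI[OF yy] by presburger+
  qed
  have "inverse (of_int q) \<notin> A"
  proof
    assume "inverse (of_int q) \<in> A"
    then obtain x y where xy: "inverse (of_int q :: 'a) = of_int x / of_int y" "\<not> q dvd y"
      by (auto simp: A_def)
    have "q \<noteq> 0" "y \<noteq> 0" using q xy(2) by auto
    then have "(of_int y :: 'a) = of_int (q * x)" using xy(1) by (simp add: eq0 field_simps)
    then have "y = q * x" by (rule eq[THEN iffD1])
    then show False using xy(2) by simp
  qed
  moreover have "\<exists>b\<in>A. \<exists>k. c * b = of_int q ^ k" if c: "c \<in> A" "c \<noteq> 0" for c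
  proof -
    obtain x y where xy: "c = of_int x / of_int y" "\<not> q dvd y" using c(1) by (auto simp: A_def)
    have "x \<noteq> 0" "y \<noteq> 0" using c(2) xy by auto
    then obtain x' where x': "x = q ^ multiplicity q x * x'" "\<not> q dvd x'"
      using multiplicity_decompose'[of x q] q by (metis not_prime_unit)
    have "x' \<noteq> 0" using x'(2) by auto
    then have "c * (of_int y / of_int x') = of_int q ^ multiplicity q x"
      using \<open>y \<noteq> 0\<close> by (subst xy(1), subst x'(1)) (simp add: eq0)
    then show ?thesis using AI[OF x'(2)] by blast
  qed
  moreover have "\<exists>f\<in>polys_over A. f \<noteq> 0 \<and> poly f e = 0" for e
  proof -
    have "polys_over (range of_int) \<subseteq> polys_over A"
      by (rule polys_over_mono) (use intA in blast)
    then show ?thesis using alg[of e] by (auto simp: transcendental_over_def)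
  qed
  ultimately obtain V where V: "maximal_subring_nonunit (of_int q :: 'a) V"
    using ex_maximal_subring_nonunit[OF sub intA] by blast
  then have subV: "is_subring V" by (rule maximal_subring_nonunitD)
  obtain m where m: "n = p * m" using p(2) by blast
  then have "(of_int (int m) :: 'a) \<noteq> 0" using n eq0 by (metis less_nat_zero_code mult_0_right of_nat_eq_0_iff)
  then have "maximal_subring_nonunit (of_int q * of_nat m) V"
    by (intro maximal_subring_nonunit_mult[OF V] subringD(8)[OF subV]) simp
  then show ?thesis using m by (auto simp: q_def)
qed

lemma sylvester_of_nat: "\<exists>m>1. sylvester (of_nat 2 :: 'a::field) n = of_nat m"
proof (induction n)
  case 0
  show ?case by (rule exI[of _ 2]) simp
next
  case (Suc n)
  then obtain m where m: "m > 1" "sylvester (of_nat 2 :: 'a) n = of_nat m" by blast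
  obtain k where k: "m = Suc k" "k > 0" using m(1) by (cases m) auto
  have "sylvester (of_nat 2 :: 'a) (Suc n) = of_nat (1 + m * k)"
    unfolding sylvester.simps m(2) by (simp add: k(1) power2_eq_square algebra_simps)
  moreover have "1 + m * k > 1" using m(1) k(2) by simp
  ultimately show ?case by blast
qed

lemma ex_independent_subrings_if_not_algebraic:
  assumes "CHAR('a::field) = 0 \<or> (\<exists>x::'a. transcendental_over (range of_int) x)"
  shows "\<exists>(a :: nat \<Rightarrow> 'a) V. independent_subrings a V"
proof (cases "\<exists>x::'a. transcendental_over (range of_int) x")
  case True
  then obtain x :: 'a where "transcendental_over (range of_int) x" by blast
  then have "\<exists>V. independent_subrings (sylvester x) V"
    by (intro ex_independent_subrings maximal_subring_nonunit_transcendental transcendental_sylvester)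
  then show ?thesis by blast
next
  case False
  have "\<exists>V. maximal_subring_nonunit (sylvester (of_nat 2 :: 'a) n) V" for n
    using sylvester_of_nat[of n] maximal_subring_nonunit_of_nat assms False by metis
  then show ?thesis using ex_independent_subrings by blast
qed

section \<open>Ideals of the divisibility order\<close>

definition dvd_ideal :: "nat set \<Rightarrow> bool"
  where "dvd_ideal D \<longleftrightarrow> 1 \<in> D \<and> 0 \<notin> D \<and> (\<forall>n\<in>D. \<forall>d. d dvd n \<longrightarrow> d \<in> D) \<and>
    (\<forall>m\<in>D. \<forall>n\<in>D. lcm m n \<in> D)"

text \<open>The analogue of \<^const>\<open>maximal_subring\<close>, matched with it by the degree map below.\<close>
definition maximal_dvd_ideal :: "nat set \<Rightarrow> nat set \<Rightarrow> bool"
  where "maximal_dvd_ideal D' D \<longleftrightarrow> dvd_ideal D' \<and> D' \<subset> D \<and>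
    (\<forall>D''. dvd_ideal D'' \<and> D'' \<subset> D \<and> D' \<subseteq> D'' \<longrightarrow> D'' = D')"

definition lower_ideal :: "nat set \<Rightarrow> nat \<Rightarrow> nat set"
  where "lower_ideal D p = {n \<in> D. \<not> p ^ o_exp D p dvd n}"

text \<open>The prime power \<open>p ^ k\<close> is recorded as the pair \<open>(p, k)\<close>. If \<open>T_fin D\<close> is finite, the number of pairs is the
sum of the \<open>o_exp D p\<close>, and each step of a chain of subrings removes one pair.\<close>
definition levels :: "nat set \<Rightarrow> (nat \<times> nat) set"
  where "levels D = {(p, k). p \<in> T_fin D \<and> 0 < k \<and> p ^ k \<in> D}"

lemma dvd_idealD:
  assumes "dvd_ideal D"
  shows "1 \<in> D" "0 \<notin> D" "n \<in> D \<Longrightarrow> d dvd n \<Longrightarrow> d \<in> D" "m \<in> D \<Longrightarrow> n \<in> D \<Longrightarrow> lcm m n \<in> D"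
  using assms by (auto simp: dvd_ideal_def)

lemma prime_power_in_ideal_iff:
  assumes D: "dvd_ideal D" and p: "p \<in> T_fin D"
  shows "p ^ k \<in> D \<longleftrightarrow> k \<le> o_exp D p" and "o_exp D p > 0"
proof -
  have pD: "p \<in> D" "prime p" "p \<notin> T_inf D" using p by (auto simp: T_fin_def)
  then obtain n where n: "n > 0" "p ^ n \<notin> D" by (auto simp: T_inf_def)
  have bound: "m \<le> n" if "m > 0 \<and> p ^ m \<in> D" for m
    using n(2) that dvd_idealD(3)[OF D, of "p ^ m" "p ^ n"] le_imp_power_dvd[of n m p] nat_le_linear by blast
  have *: "o_exp D p > 0 \<and> p ^ o_exp D p \<in> D"
    unfolding o_exp_def by (rule GreatestI_nat[where k = 1 and b = n]) (use pD bound in auto)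
  then show "o_exp D p > 0" by simp
  have "k \<le> o_exp D p" if "p ^ k \<in> D"
  proof (cases "k = 0")
    case False
    then show ?thesis
      unfolding o_exp_def using that bound by (intro Greatest_le_nat[where b = n]) auto
  qed simp
  moreover have "p ^ k \<in> D" if "k \<le> o_exp D p"
    using * that dvd_idealD(3)[OF D] le_imp_power_dvd by blast
  ultimately show "p ^ k \<in> D \<longleftrightarrow> k \<le> o_exp D p" by blast
qed

text \<open>A number is the least common multiple of the prime powers that divide it.\<close>
lemma in_ideal_if_prime_powers:
  assumes D: "dvd_ideal D"
  shows "n > 0 \<Longrightarrow> (\<And>p k. prime p \<Longrightarrow> p ^ k dvd n \<Longrightarrow> p ^ k \<in> D) \<Longrightarrow> n \<in> D"
proof (induction n rule: less_induct)
  case (less n)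
  show ?case
  proof (cases "n = 1")
    case True
    then show ?thesis using dvd_idealD(1)[OF D] by simp
  next
    case False
    then obtain p where p: "prime p" "p dvd n" using prime_factor_nat by blast
    obtain m where m: "n = p ^ multiplicity p n * m" "\<not> p dvd m"
      using less.prems(1) p(1) multiplicity_decompose'[of n p] by (metis not_prime_unit neq0_conv)
    have k: "multiplicity p n > 0"
      using p less.prems(1) by (simp add: prime_multiplicity_gt_zero_iff)
    have "coprime (p ^ multiplicity p n) m"
      using p(1) m(2) by (simp add: prime_imp_coprime)
    then have eq: "n = lcm (p ^ multiplicity p n) m" using m(1) by (simp add: lcm_coprime)
    have "p ^ multiplicity p n > 1" using k p(1) by (metis one_less_power prime_gt_1_nat)
    moreover have "m > 0" using m(1) less.prems(1) by (metis gr0I mult_0_right neq0_conv)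
    ultimately have "m < n" using m(1) by (metis mult_less_cancel2 nat_mult_1)
    moreover have "m dvd n" using m(1) by (metis dvd_triv_right)
    ultimately have "m \<in> D"
      using less.IH[of m] \<open>m > 0\<close> less.prems(2) dvd_trans by blast
    moreover have "p ^ multiplicity p n \<in> D"
      using less.prems(2)[OF p(1)] multiplicity_dvd by blast
    ultimately show ?thesis using eq dvd_idealD(4)[OF D] by metis
  qed
qed

lemma prime_power_dvd_lcm_iff:
  fixes p :: nat
  assumes "prime p" "m > 0" "n > 0"
  shows "p ^ k dvd lcm m n \<longleftrightarrow> p ^ k dvd m \<or> p ^ k dvd n"
proof -
  have "multiplicity p (lcm m n) = max (multiplicity p m) (multiplicity p n)"
    using assms by (simp add: prime_factorization_lcm flip: count_prime_factorization_prime)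
  moreover have "p \<noteq> Suc 0" using assms(1) by auto
  ultimately show ?thesis
    using assms by (auto simp: power_dvd_iff_le_multiplicity le_max_iff_disj lcm_eq_0_iff)
qed

text \<open>For a prime power, not dividing \<open>m\<close> and not dividing \<open>n\<close> implies not dividing their least common multiple.\<close>
lemma dvd_ideal_not_dvd:
  assumes D: "dvd_ideal D" and p: "prime p" and k: "k > 0"
  shows "dvd_ideal {n \<in> D. \<not> p ^ k dvd n}"
proof -
  have "\<not> p ^ k dvd 1" using p k by (simp add: nat_power_eq_Suc_0_iff) (metis not_prime_1 One_nat_def)
  moreover have "\<not> p ^ k dvd lcm m n" if "m \<in> D" "n \<in> D" "\<not> p ^ k dvd m" "\<not> p ^ k dvd n" for m n
    using prime_power_dvd_lcm_iff[OF p, of m n k] that dvd_idealD(2)[OF D] by (metis gr0I)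
  ultimately show ?thesis
    using D unfolding dvd_ideal_def by (auto dest: dvd_trans)
qed

lemma dvd_ideal_lower: "dvd_ideal D \<Longrightarrow> p \<in> T_fin D \<Longrightarrow> dvd_ideal (lower_ideal D p)"
  unfolding lower_ideal_def
  by (rule dvd_ideal_not_dvd) (auto simp: T_fin_def prime_power_in_ideal_iff)

text \<open>A larger ideal contains a multiple of the top power of \<open>p\<close>, hence this power, hence all prime powers
of \<open>D\<close>.\<close>
lemma maximal_lower_ideal:
  assumes D: "dvd_ideal D" and p: "p \<in> T_fin D"
  shows "maximal_dvd_ideal (lower_ideal D p) D"
proof -
  define k where "k = o_exp D p"
  have pk: "p ^ k \<in> D" "p ^ Suc k \<notin> D"
    using prime_power_in_ideal_iff(1)[OF D p] by (auto simp: k_def simp del: power_Suc)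
  have prime: "prime p" using p by (simp add: T_fin_def)
  have "lower_ideal D p \<subset> D"
    using pk(1) dvd_refl[of "p ^ k"] unfolding lower_ideal_def k_def by blast
  moreover have "D'' = lower_ideal D p"
    if D'': "dvd_ideal D''" "D'' \<subset> D" "lower_ideal D p \<subseteq> D''" for D''
  proof (rule ccontr)
    assume "D'' \<noteq> lower_ideal D p"
    then obtain n where n: "n \<in> D''" "n \<in> D" "p ^ k dvd n"
      using D''(2,3) by (auto simp: lower_ideal_def k_def)
    have pkD'': "p ^ k \<in> D''" using dvd_idealD(3)[OF D''(1)] n by blast
    have "m \<in> D''" if m: "m \<in> D" for m
    proof (rule in_ideal_if_prime_powers[OF D''(1)])
      show "m > 0" using m dvd_idealD(2)[OF D] by (metis gr0I)
      fix r j assume r: "prime r" "r ^ j dvd m"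
      then have rD: "r ^ j \<in> D" using m dvd_idealD(3)[OF D] by blast
      show "r ^ j \<in> D''"
      proof (cases "p ^ k dvd r ^ j")
        case False
        then show ?thesis using rD D''(3) by (auto simp: lower_ideal_def k_def)
      next
        case True
        have "k > 0" using prime_power_in_ideal_iff(2)[OF D p] by (simp add: k_def)
        then have "r = p" using True r(1) prime
          by (metis dvd_power dvd_trans prime_dvd_power primes_dvd_imp_eq)
        then have "j \<le> k" using rD prime_power_in_ideal_iff(1)[OF D p] by (simp add: k_def)
        then show ?thesis using pkD'' \<open>r = p\<close> dvd_idealD(3)[OF D''(1)] le_imp_power_dvd by blast
      qed
    qed
    then show False using D''(2) by blast
  qed
  ultimately show ?thesis
    using dvd_ideal_lower[OF D p] by (auto simp: maximal_dvd_ideal_def)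
qed

text \<open>Conversely, if \<open>p ^ k\<close> is the first power of some prime that is missing in the maximal ideal \<open>D'\<close> but lies
in \<open>D\<close>, then \<open>D'\<close> consists of all \<open>n\<close> in \<open>D\<close> that \<open>p ^ k\<close> does not divide. If \<open>p ^ Suc k\<close> were in \<open>D\<close>, it
could take the place of \<open>p ^ k\<close> here, and this would put \<open>p ^ k\<close> into \<open>D'\<close>.\<close>
lemma maximal_dvd_ideal_iff:
  assumes D: "dvd_ideal D"
  shows "maximal_dvd_ideal D' D \<longleftrightarrow> (\<exists>p\<in>T_fin D. D' = lower_ideal D p)"
proof
  assume max: "maximal_dvd_ideal D' D"
  then have D': "dvd_ideal D'" "D' \<subset> D" by (auto simp: maximal_dvd_ideal_def)
  then obtain n where n: "n \<in> D" "n \<notin> D'" by blast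
  then have "n > 0" using dvd_idealD(2)[OF D] by (metis gr0I)
  with n in_ideal_if_prime_powers[OF D'(1), of n]
  obtain p j where pj: "prime p" "p ^ j dvd n" "p ^ j \<notin> D'" by blast
  define k where "k = (LEAST j. p ^ j \<notin> D')"
  have k: "p ^ k \<notin> D'" "k \<le> j" unfolding k_def using pj(3) by (rule LeastI, rule Least_le)
  have "p ^ k \<in> D" using dvd_idealD(3)[OF D] n(1) pj(2) k(2) le_imp_power_dvd dvd_trans by blast
  have "k > 0" using k(1) dvd_idealD(1)[OF D'(1)] by (cases k) auto
  have eq: "{n \<in> D. \<not> p ^ i dvd n} = D'" if "i \<ge> k" "p ^ i \<in> D" for i
  proof -
    have "\<not> p ^ i dvd m" if "m \<in> D'" for m
      using that dvd_idealD(3)[OF D'(1)] k(1) le_imp_power_dvd[OF \<open>i \<ge> k\<close>, of p] by (metis dvd_trans)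
    then have "D' \<subseteq> {n \<in> D. \<not> p ^ i dvd n}" using D'(2) by blast
    moreover have "{n \<in> D. \<not> p ^ i dvd n} \<subset> D" using that(2) dvd_refl[of "p ^ i"] by blast
    moreover have "dvd_ideal {n \<in> D. \<not> p ^ i dvd n}"
      using dvd_ideal_not_dvd[OF D pj(1)] that(1) \<open>k > 0\<close> by auto
    ultimately show ?thesis using max unfolding maximal_dvd_ideal_def by blast
  qed
  have Suc: "p ^ Suc k \<notin> D"
  proof
    assume *: "p ^ Suc k \<in> D"
    have "\<not> p ^ Suc k dvd p ^ k"
      using pj(1) power_dvd_imp_le[of p "Suc k" k] prime_gt_1_nat[of p] by linarith
    then have "p ^ k \<in> {n \<in> D. \<not> p ^ Suc k dvd n}" using \<open>p ^ k \<in> D\<close> by blast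
    with eq[OF _ *] k(1) show False by simp
  qed
  have "p \<in> D" using \<open>p ^ k \<in> D\<close> \<open>k > 0\<close> dvd_idealD(3)[OF D] by (meson dvd_power)
  then have p: "p \<in> T_fin D" using pj(1) Suc unfolding T_fin_def T_inf_def by blast
  have "o_exp D p = k"
    using prime_power_in_ideal_iff(1)[OF D p, of k] prime_power_in_ideal_iff(1)[OF D p, of "Suc k"] Suc \<open>p ^ k \<in> D\<close>
    by auto
  then show "\<exists>p\<in>T_fin D. D' = lower_ideal D p"
    using p eq[of k] \<open>p ^ k \<in> D\<close> by (auto simp: lower_ideal_def)
qed (use maximal_lower_ideal[OF D] in blast)

lemma prime_power_in_lower_ideal_iff:
  assumes D: "dvd_ideal D" and p: "p \<in> T_fin D" and r: "prime r"
  shows "r ^ k \<in> lower_ideal D p \<longleftrightarrow> r ^ k \<in> D \<and> (r = p \<longrightarrow> k \<noteq> o_exp D p)"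
proof (cases "r = p")
  case True
  have "p > 1" using p prime_gt_1_nat by (auto simp: T_fin_def)
  then show ?thesis
    using True prime_power_in_ideal_iff(1)[OF D p]
    by (auto simp: lower_ideal_def power_dvd_imp_le intro!: le_imp_power_dvd dest: power_dvd_imp_le)
next
  case False
  have "prime p" using p by (simp add: T_fin_def)
  then have "\<not> p ^ o_exp D p dvd r ^ k"
    using False r prime_power_in_ideal_iff(2)[OF D p]
    by (metis dvd_power dvd_trans prime_dvd_power primes_dvd_imp_eq)
  then show ?thesis using False by (simp add: lower_ideal_def)
qed

lemma T_inf_lower_ideal:
  assumes D: "dvd_ideal D" and p: "p \<in> T_fin D"
  shows "T_inf (lower_ideal D p) = T_inf D"
proof -
  have "r \<in> T_inf (lower_ideal D p) \<longleftrightarrow> r \<in> T_inf D" if "prime r" for r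
  proof (cases "r = p")
    case True
    have "p \<notin> T_inf D" using p by (simp add: T_fin_def)
    then show ?thesis using True prime_power_in_lower_ideal_iff[OF D p that] by (auto simp: T_inf_def)
  next
    case False
    then show ?thesis using prime_power_in_lower_ideal_iff[OF D p that] by (auto simp: T_inf_def)
  qed
  then show ?thesis by (auto simp: T_inf_def)
qed

lemma levels_lower_ideal:
  assumes D: "dvd_ideal D" and p: "p \<in> T_fin D"
  shows "levels (lower_ideal D p) = levels D - {(p, o_exp D p)}"
proof -
  have *: "(r, k) \<in> levels D' \<longleftrightarrow> prime r \<and> r \<notin> T_inf D' \<and> k > 0 \<and> r ^ k \<in> D'"
    if "dvd_ideal D'" for D' r k
    using dvd_idealD(3)[OF that, of "r ^ k" r] by (auto simp: levels_def T_fin_def)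
  have "(r, k) \<in> levels (lower_ideal D p) \<longleftrightarrow> (r, k) \<in> levels D - {(p, o_exp D p)}" for r k
    using prime_power_in_lower_ideal_iff[OF D p, of r k]
    by (auto simp: *[OF D] *[OF dvd_ideal_lower[OF D p]] T_inf_lower_ideal[OF D p])
  then show ?thesis by auto
qed

lemma top_level_in_levels:
  assumes "dvd_ideal D" "p \<in> T_fin D"
  shows "(p, o_exp D p) \<in> levels D"
  using assms prime_power_in_ideal_iff[OF assms] by (auto simp: levels_def)

lemma levels_eq_Sigma:
  assumes D: "dvd_ideal D"
  shows "levels D = (SIGMA p:T_fin D. {1..o_exp D p})"
  using prime_power_in_ideal_iff(1)[OF D] by (auto simp: levels_def)

lemma finite_levels_iff:
  assumes D: "dvd_ideal D"
  shows "finite (levels D) \<longleftrightarrow> finite (T_fin D)"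
proof
  assume "finite (levels D)"
  moreover have "T_fin D = fst ` levels D" using top_level_in_levels[OF D] by (force simp: levels_def)
  ultimately show "finite (T_fin D)" by simp
qed (simp add: levels_eq_Sigma[OF D])

lemma card_levels:
  assumes "dvd_ideal D"
  shows "finite (T_fin D) \<Longrightarrow> card (levels D) = (\<Sum>p\<in>T_fin D. o_exp D p)"
  by (simp add: levels_eq_Sigma[OF assms] )

lemma levels_empty_iff:
  assumes D: "dvd_ideal D"
  shows "levels D = {} \<longleftrightarrow> T_fin D = {}"
proof
  assume "levels D = {}"
  then show "T_fin D = {}" using top_level_in_levels[OF D] by blast
qed (simp add: levels_def)

text \<open>Where chains end: all primes of \<open>D\<close> occur in \<open>D\<close> with all their powers.\<close>
lemma eq_T_prime_if_no_T_fin: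
  assumes D: "dvd_ideal D" and "T_fin D = {}"
  shows "D = T_prime D"
proof (intro equalityI subsetI)
  fix n assume n: "n \<in> D"
  then have "n > 0" using dvd_idealD(2)[OF D] by (metis gr0I)
  then show "n \<in> T_prime D"
    using n assms(2) dvd_idealD(3)[OF D] by (auto simp: T_prime_def T_fin_def)
next
  fix n assume n: "n \<in> T_prime D"
  show "n \<in> D"
  proof (rule in_ideal_if_prime_powers[OF D])
    show "n > 0" using n by (simp add: T_prime_def)
    fix p k assume pk: "prime p" "p ^ k dvd n"
    show "p ^ k \<in> D"
    proof (cases "k = 0")
      case True
      then show ?thesis using dvd_idealD(1)[OF D] by simp
    next
      case False
      then have "p dvd n" using pk(2) dvd_power[of k p] dvd_trans by blast
      then show ?thesis using n pk(1) False by (auto simp: T_prime_def T_inf_def)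
    qed
  qed
qed

section \<open>Degrees in an absolutely algebraic field\<close>

text \<open>The elements of \<open>E\<close> in the field with \<open>q^n\<close> elements, where \<open>q\<close> is the characteristic. It is all of \<open>E\<close>
for \<open>n = 0\<close>.\<close>
definition frob_fix :: "nat \<Rightarrow> 'a::field set"
  where "frob_fix n = {x. x ^ (CHAR('a) ^ n) = x}"

text \<open>The degree of \<open>x\<close> over the prime field, if \<open>x\<close> is algebraic over it and the characteristic is positive.\<close>
definition frob_degree :: "'a::field \<Rightarrow> nat"
  where "frob_degree x = (LEAST n. n > 0 \<and> x \<in> frob_fix n)"

definition absolutely_algebraic :: "'a::field itself \<Rightarrow> bool"
  where "absolutely_algebraic _ \<longleftrightarrow> prime CHAR('a) \<and> (\<forall>x::'a. \<exists>n>0. x \<in> frob_fix n)"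

text \<open>Multiplication by \<open>x \<noteq> 0\<close> permutes the nonzero elements of \<open>K\<close>; compare the products of all of them.\<close>
lemma power_card_finite_subring:
  assumes K: "is_subring K" "finite K" and x: "x \<in> K"
  shows "x ^ card K = x"
proof (cases "x = 0")
  case True
  have "card K > 0" using K(2) x by (auto simp: card_gt_0_iff)
  then show ?thesis using True by simp
next
  case False
  let ?U = "K - {0}"
  have "(\<lambda>y. x * y) ` ?U = ?U"
  proof (rule endo_inj_surj)
    show "(\<lambda>y. x * y) ` ?U \<subseteq> ?U" using False x subringD(4)[OF K(1)] by auto
  qed (use K(2) False in \<open>auto simp: inj_on_def\<close>)
  then have "\<Prod>?U = \<Prod>((\<lambda>y. x * y) ` ?U)" by simp
  also have "\<dots> = (\<Prod>y\<in>?U. x * y)" using False by (subst prod.reindex) (auto simp: inj_on_def)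
  also have "\<dots> = x ^ card ?U * \<Prod>?U" by (simp add: prod.distrib)
  finally have "x ^ card ?U = 1" using K(2) by (auto simp: prod_zero_iff)
  moreover have "card K = Suc (card ?U)"
    by (rule card.remove[OF K(2) subringD(2)[OF K(1)]])
  ultimately show ?thesis by simp
qed

text \<open>The sums \<open>\<Sum>i<k. c i * x ^ i\<close> with coefficients in \<open>K\<close> are all different: if two of them agreed, the
difference of the corresponding polynomials would vanish at \<open>x\<close>, and therefore at its \<open>k\<close> conjugates over
\<open>K\<close>, although it has degree less than \<open>k\<close>.\<close>
lemma span_of_conjugates:
  fixes x :: "'a::field"
  assumes char: "prime CHAR('a)" and S: "is_subring S" and K: "is_subring K" "K \<subseteq> S" "finite K" "K \<subseteq> frob_fix m"
    and x: "x \<in> S" and inj: "inj_on (\<lambda>i. x ^ (CHAR('a) ^ (m * i))) {..<k}"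
  shows "\<exists>C\<subseteq>S. card C = card K ^ k"
proof -
  define val where "val c = (\<Sum>i<k. c i * x ^ i)" for c :: "nat \<Rightarrow> 'a"
  let ?F = "PiE {..<k} (\<lambda>_. K)"
  have "inj_on val ?F"
  proof (rule inj_onI)
    fix c d assume c: "c \<in> ?F" and d: "d \<in> ?F" and eq: "val c = val d"
    define g where "g = (\<Sum>i<k. monom (c i - d i) i)"
    have coeff: "poly.coeff g i = (if i < k then c i - d i else 0)" for i
      by (simp add: g_def coeff_sum if_distrib cong: if_cong)
    have "poly g (x ^ (CHAR('a) ^ (m * j))) = 0" for j
    proof -
      let ?Q = "CHAR('a) ^ (m * j)"
      have frob: "(c i - d i) ^ ?Q = c i - d i" if "i < k" for i
      proof -
        have "c i - d i \<in> frob_fix m" using c d that K(1,4) subringD(3) by fastforce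
        then have *: "(c i - d i) ^ (CHAR('a) ^ m) = c i - d i" by (simp add: frob_fix_def)
        show ?thesis
          by (induction j) (simp_all add: power_add power_mult *)
      qed
      have "poly g (x ^ ?Q) = (\<Sum>i<k. (c i - d i) * (x ^ ?Q) ^ i)"
        by (simp add: g_def poly_sum poly_monom)
      also have "\<dots> = (\<Sum>i<k. ((c i - d i) * x ^ i) ^ ?Q)"
        using frob by (intro sum.cong) (auto simp: power_mult_distrib mult.commute simp flip: power_mult)
      also have "\<dots> = (\<Sum>i<k. (c i - d i) * x ^ i) ^ ?Q"
        by (rule freshmans_dream_sum'[OF char refl, symmetric])
      also have "(\<Sum>i<k. (c i - d i) * x ^ i) = 0"
        using eq by (simp add: val_def left_diff_distrib sum_subtractf)
      finally show ?thesis using char by (simp add: prime_gt_0_nat)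
    qed
    then have roots: "(\<lambda>i. x ^ (CHAR('a) ^ (m * i))) ` {..<k} \<subseteq> {y. poly g y = 0}" by auto
    have "g = 0"
    proof (rule ccontr)
      assume g: "g \<noteq> 0"
      then have "k \<le> card {y. poly g y = 0}"
        using card_mono[OF poly_roots_finite[OF g] roots] by (simp add: card_image[OF inj])
      also have "\<dots> \<le> Polynomial.degree g" by (rule card_poly_roots_bound[OF g])
      finally have "poly.coeff g (Polynomial.degree g) = 0" by (simp add: coeff)
      then show False using g by simp
    qed
    show "c = d"
    proof (rule PiE_ext[OF c d])
      fix i assume "i \<in> {..<k}"
      then show "c i = d i" using coeff[of i] \<open>g = 0\<close> by simp
    qed
  qed
  then have "card (val ` ?F) = card K ^ k" using card_image by (fastforce simp: card_PiE)
  moreover have "val ` ?F \<subseteq> S"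
  proof safe
    fix c assume c: "c \<in> ?F"
    show "val c \<in> S" unfolding val_def
    proof (rule subring_sum[OF S])
      fix i assume "i \<in> {..<k}"
      then have "c i \<in> S" using c K(2) by auto
      then show "c i * x ^ i \<in> S" by (rule subringD(4)[OF S _ subringD(7)[OF S x]])
    qed
  qed
  ultimately show ?thesis by blast
qed

context
  assumes char: "prime CHAR('a::field)"
begin

lemma is_subring_frob_fix: "is_subring (frob_fix n :: 'a set)"
  unfolding is_subring_iff
proof (intro conjI ballI)
  let ?Q = "CHAR('a) ^ n"
  show "(1::'a) \<in> frob_fix n" by (simp add: frob_fix_def)
  fix x y :: 'a assume xy: "x \<in> frob_fix n" "y \<in> frob_fix n"
  have "((x - y) + y) ^ ?Q = (x - y) ^ ?Q + y ^ ?Q" by (rule freshmans_dream'[OF char refl])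
  then show "x - y \<in> frob_fix n" using xy by (simp add: frob_fix_def eq_diff_eq)
  show "x * y \<in> frob_fix n" using xy by (simp add: frob_fix_def power_mult_distrib)
qed

lemma frobenius_inj:
  fixes x y :: 'a
  assumes "x ^ (CHAR('a) ^ n) = y ^ (CHAR('a) ^ n)"
  shows "x = y"
proof -
  let ?Q = "CHAR('a) ^ n"
  have "((x - y) + y) ^ ?Q = (x - y) ^ ?Q + y ^ ?Q" by (rule freshmans_dream'[OF char refl])
  then show ?thesis using assms by simp
qed

lemma frob_fix_shift: "(x::'a) ^ (CHAR('a) ^ m) = x ^ (CHAR('a) ^ (m + n)) \<longleftrightarrow> x \<in> frob_fix n"
proof -
  have "x ^ (CHAR('a) ^ (m + n)) = (x ^ (CHAR('a) ^ n)) ^ (CHAR('a) ^ m)"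
    by (simp add: power_add mult.commute flip: power_mult)
  then show ?thesis using frobenius_inj[of "x ^ (CHAR('a) ^ n)" m x] by (auto simp: frob_fix_def)
qed

lemma frob_fix_mono: "m dvd n \<Longrightarrow> frob_fix m \<subseteq> (frob_fix n :: 'a set)"
proof (elim dvdE, hypsubst, rule subsetI)
  fix k and x :: 'a assume x: "x \<in> frob_fix m"
  show "x \<in> frob_fix (m * k)"
    by (induction k) (use x in \<open>simp_all add: frob_fix_def power_add power_mult\<close>)
qed

lemma card_frob_fix_le:
  assumes "n > 0"
  shows "finite (frob_fix n :: 'a set)" and "card (frob_fix n :: 'a set) \<le> CHAR('a) ^ n"
proof -
  let ?Q = "CHAR('a) ^ n"
  define f :: "'a poly" where "f = monom 1 ?Q - [:0, 1:]"
  have Q: "?Q > 1" by (rule one_less_power[OF prime_gt_1_nat[OF char] assms])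
  have "poly.coeff f ?Q = 1" using Q assms by (simp add: f_def coeff_pCons split: nat.split)
  then have f: "f \<noteq> 0" by auto
  have deg: "Polynomial.degree f \<le> ?Q"
    unfolding f_def using Q by (intro degree_diff_le degree_monom_le) auto
  have eq: "frob_fix n = {x. poly f x = 0}"
    by (auto simp: f_def frob_fix_def poly_monom)
  show "finite (frob_fix n :: 'a set)" unfolding eq by (rule poly_roots_finite[OF f])
  show "card (frob_fix n :: 'a set) \<le> ?Q" unfolding eq
    by (rule order_trans[OF card_poly_roots_bound[OF f] deg])
qed

text \<open>The polynomial \<open>X^q - X\<close> has at most \<open>q\<close> roots, and the \<open>q\<close> multiples of \<open>1\<close> are among them.\<close>
lemma prime_subfield: "frob_fix 1 = range (of_int :: int \<Rightarrow> 'a)" and card_frob_fix_1: "card (frob_fix 1 :: 'a set) = CHAR('a)"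
proof -
  let ?q = "CHAR('a)"
  have inj: "inj_on (of_nat :: nat \<Rightarrow> 'a) {..<?q}"
    by (auto simp: inj_on_def of_nat_eq_iff_cong_CHAR cong_def)
  have sub: "of_nat ` {..<?q} \<subseteq> (frob_fix 1 :: 'a set)"
    using subringD(8)[OF is_subring_frob_fix] by auto
  have eq: "of_nat ` {..<?q} = (frob_fix 1 :: 'a set)"
    by (rule card_seteq[OF card_frob_fix_le(1) sub])
      (use card_frob_fix_le(2)[of 1] in \<open>simp_all add: card_image[OF inj]\<close>)
  then show "card (frob_fix 1 :: 'a set) = CHAR('a)" using card_image[OF inj] by simp
  have "of_nat ` {..<?q} \<subseteq> range (of_int :: int \<Rightarrow> 'a)"
  proof safe
    fix k show "(of_nat k :: 'a) \<in> range of_int" by (metis of_int_of_nat_eq rangeI)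
  qed
  then show "frob_fix 1 = range (of_int :: int \<Rightarrow> 'a)"
    using eq subringD(9)[OF is_subring_frob_fix] by auto
qed

text \<open>The powers of an element that is algebraic over the finite prime field \<open>P\<close> take finitely many values,
since they reduce to polynomials over \<open>P\<close> of bounded degree. So two iterates \<open>x^(q^i)\<close> and \<open>x^(q^j)\<close>
coincide, and the Frobenius map is injective.\<close>
lemma absolutely_algebraic_if_algebraic:
  assumes alg: "\<And>x::'a. \<not> transcendental_over (range of_int) x"
  shows "absolutely_algebraic TYPE('a)"
  unfolding absolutely_algebraic_def
proof (intro conjI allI char)
  fix x :: 'a
  let ?P = "range of_int :: 'a set"
  have P: "is_subring ?P" "finite ?P"
    using is_subring_frob_fix card_frob_fix_le(1)[of 1] by (simp_all flip: prime_subfield)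
  obtain f where f: "f \<in> polys_over ?P" "f \<noteq> 0" "poly f x = 0"
    using alg by (auto simp: transcendental_over_def)
  define n where "n = Polynomial.degree f"
  define c where "c = Polynomial.lead_coeff f"
  have "c \<in> ?P" unfolding c_def by (rule polys_overD[OF f(1)])
  then have "c ^ CHAR('a) = c" using prime_subfield by (auto simp: frob_fix_def)
  moreover obtain r where r: "CHAR('a) = Suc (Suc r)"
    using prime_ge_2_nat[OF char] nat_le_iff_add[of 2 "CHAR('a)"] by auto
  moreover have "c \<noteq> 0" using f(2) by (simp add: c_def)
  ultimately have cinv: "c ^ r * c = 1" by (simp add: mult.commute)
  define g where "g = smult (c ^ r) f"
  have g: "g \<in> polys_over ?P" "poly g x = 0" "Polynomial.degree g = n" "poly.coeff g n = 1"
    using \<open>c \<in> ?P\<close> f cinv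
    by (auto simp: g_def n_def c_def[symmetric] intro!: polys_over_closed[OF P(1)] subringD[OF P(1)])
  have "n > 0"
  proof (rule ccontr)
    assume "\<not> n > 0"
    then obtain a where "g = [:a:]" using g(3) by (metis degree_eq_zeroE neq0_conv)
    then show False using g by auto
  qed
  define \<R> where "\<R> = {r \<in> polys_over ?P. Polynomial.degree r < n}"
  have "\<exists>r\<in>\<R>. x ^ k = poly r x" for k
  proof (induction k)
    case 0
    show ?case using \<open>n > 0\<close> by (intro bexI[of _ 1]) (auto simp: \<R>_def polys_over_closed[OF P(1)])
  next
    case (Suc k)
    then obtain r where r: "r \<in> polys_over ?P" "Polynomial.degree r < n" "x ^ k = poly r x"
      by (auto simp: \<R>_def)
    let ?r = "pCons 0 r"
    have r': "?r \<in> polys_over ?P" "x ^ Suc k = poly ?r x"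
      using r by (auto intro!: polys_over_closed[OF P(1)] subringD[OF P(1)])
    show ?case
    proof (cases "Polynomial.degree ?r < n")
      case True
      then show ?thesis using r' by (auto simp: \<R>_def)
    next
      case False
      then have deg: "Polynomial.degree ?r = n" using r(2) by (simp split: if_splits)
      let ?s = "?r - monom (poly.coeff ?r n) (n - n) * g"
      have "Polynomial.degree ?s < n" by (rule degree_drop) (use deg \<open>n > 0\<close> g in auto)
      moreover have "?s \<in> polys_over ?P"
        by (intro polys_over_closed[OF P(1)] r' g polys_overD[OF r'(1)])
      moreover have "x ^ Suc k = poly ?s x" using r'(2) g(2) by simp
      ultimately show ?thesis by (auto simp: \<R>_def)
    qed
  qed
  then have "range (\<lambda>k. x ^ (CHAR('a) ^ k)) \<subseteq> (\<lambda>r. poly r x) ` \<R>" by blast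
  moreover have "finite \<R>"
  proof (rule finite_subset)
    show "\<R> \<subseteq> (\<lambda>c. \<Sum>i<n. monom (c i) i) ` (PiE {..<n} (\<lambda>_. ?P))"
    proof
      fix r assume r: "r \<in> \<R>"
      then have "poly.coeff r i = 0" if "\<not> i < n" for i
        using that by (auto simp: \<R>_def coeff_eq_0)
      then have "r = (\<Sum>i<n. monom (restrict (poly.coeff r) {..<n} i) i)"
        by (intro poly_eqI) (auto simp: coeff_sum if_distrib cong: if_cong)
      moreover have "restrict (poly.coeff r) {..<n} \<in> PiE {..<n} (\<lambda>_. ?P)"
        using r polys_overD[of r ?P] unfolding \<R>_def by auto
      ultimately show "r \<in> (\<lambda>c. \<Sum>i<n. monom (c i) i) ` (PiE {..<n} (\<lambda>_. ?P))" by blast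
    qed
  qed (intro finite_imageI finite_PiE P(2) finite_lessThan)
  ultimately have "finite (range (\<lambda>k. x ^ (CHAR('a) ^ k)))" by (meson finite_imageI finite_subset)
  then have "\<not> inj (\<lambda>k. x ^ (CHAR('a) ^ k))" using range_inj_infinite by blast
  then obtain i j where "x ^ (CHAR('a) ^ i) = x ^ (CHAR('a) ^ j)" "i < j"
    unfolding inj_def by (metis linorder_neqE_nat)
  then have "x \<in> frob_fix (j - i)" using frob_fix_shift[of x i "j - i"] by simp
  then show "\<exists>n>0. x \<in> frob_fix n" using \<open>i < j\<close> by (intro exI[of _ "j - i"]) simp
qed

end

context
  assumes aa: "absolutely_algebraic TYPE('a::field)"
begin

lemma prime_char: "prime CHAR('a)" using aa by (simp add: absolutely_algebraic_def)

lemma frob_degree_pos: "frob_degree (x::'a) > 0" and in_frob_fix_degree: "x \<in> frob_fix (frob_degree x)"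
proof -
  have "\<exists>n>0. x \<in> frob_fix n" using aa by (simp add: absolutely_algebraic_def)
  then have "frob_degree x > 0 \<and> x \<in> frob_fix (frob_degree x)"
    unfolding frob_degree_def by (rule LeastI_ex)
  then show "frob_degree x > 0" "x \<in> frob_fix (frob_degree x)" by blast+
qed

text \<open>The \<open>n\<close> with \<open>x\<close> in \<open>frob_fix n\<close> are the periods of \<open>x\<close> under the Frobenius map; \<open>n = 0\<close> is one of them.\<close>
lemma in_frob_fix_iff: "(x::'a) \<in> frob_fix n \<longleftrightarrow> frob_degree x dvd n"
proof
  assume x: "x \<in> frob_fix n"
  let ?d = "frob_degree x"
  have "x \<in> frob_fix (?d * (n div ?d))"
    using frob_fix_mono[OF prime_char, of ?d "?d * (n div ?d)"] in_frob_fix_degree[of x] by auto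
  then have "x ^ (CHAR('a) ^ (n mod ?d)) = x ^ (CHAR('a) ^ (n mod ?d + ?d * (n div ?d)))"
    using frob_fix_shift[OF prime_char] by blast
  also have "n mod ?d + ?d * (n div ?d) = n" by simp
  finally have "x \<in> frob_fix (n mod ?d)" using x by (simp add: frob_fix_def)
  moreover have "n mod ?d < ?d" by (simp add: frob_degree_pos)
  ultimately have "n mod ?d = 0"
    using not_less_Least[of "n mod ?d" "\<lambda>n. n > 0 \<and> x \<in> frob_fix n"] by (auto simp: frob_degree_def)
  then show "?d dvd n" by (simp add: dvd_eq_mod_eq_0)
next
  assume "frob_degree x dvd n"
  then show "x \<in> frob_fix n" using frob_fix_mono[OF prime_char] in_frob_fix_degree by blast
qed

text \<open>With \<open>x\<close>, the subring \<open>S\<close> contains the polynomials in \<open>x\<close> over the field with \<open>q^m\<close> elements.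
Over this field \<open>x\<close> has \<open>l / m\<close> conjugates, so these are at least \<open>q^l\<close> elements, as many as there can be in
\<open>frob_fix l\<close>. The case \<open>m = 1\<close> describes the field generated by \<open>x\<close>, the general case shows that
degrees are closed under least common multiples.\<close>
lemma frob_fix_lcm:
  assumes S: "is_subring (S :: 'a set)" and m: "m > 0" "frob_fix m \<subseteq> S" "card (frob_fix m :: 'a set) = CHAR('a) ^ m"
    and x: "x \<in> S"
  defines "l \<equiv> lcm m (frob_degree x)"
  shows "frob_fix l \<subseteq> S" and "card (frob_fix l :: 'a set) = CHAR('a) ^ l"
proof -
  have l: "l > 0" unfolding l_def using m(1) frob_degree_pos[of x] by (simp add: lcm_pos_nat)
  define k where "k = l div m"
  have k: "m * k = l" by (simp add: k_def l_def)
  have "inj_on (\<lambda>i. x ^ (CHAR('a) ^ (m * i))) {..<k}"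
  proof (rule linorder_inj_onI)
    fix i j assume ij: "i < j" "i \<in> {..<k}" "j \<in> {..<k}"
    show "x ^ (CHAR('a) ^ (m * i)) \<noteq> x ^ (CHAR('a) ^ (m * j))"
    proof
      assume *: "x ^ (CHAR('a) ^ (m * i)) = x ^ (CHAR('a) ^ (m * j))"
      have "m * j = m * i + m * (j - i)" using ij(1) by (simp flip: add_mult_distrib2)
      then have "x \<in> frob_fix (m * (j - i))" using * frob_fix_shift[OF prime_char] by metis
      then have "l dvd m * (j - i)" by (simp add: l_def in_frob_fix_iff)
      then have "m * k \<le> m * (j - i)" using k m(1) ij(1) by (simp add: dvd_imp_le)
      then show False using m(1) ij by auto
    qed
  qed auto
  moreover have "is_subring (S \<inter> frob_fix l)"
    using S is_subring_frob_fix[OF prime_char] unfolding is_subring_iff by blast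
  moreover have "frob_fix m \<subseteq> (frob_fix l :: 'a set)" unfolding l_def by (rule frob_fix_mono[OF prime_char]) simp
  moreover have "x \<in> S \<inter> frob_fix l" using x by (simp add: in_frob_fix_iff l_def)
  ultimately obtain C where C: "C \<subseteq> S \<inter> frob_fix l" "card C = (CHAR('a) ^ m) ^ k"
    using span_of_conjugates[OF prime_char, of "S \<inter> frob_fix l" "frob_fix m" m x k]
      is_subring_frob_fix[OF prime_char] m card_frob_fix_le[OF prime_char m(1)] by auto
  then have card: "card C = CHAR('a) ^ l" using k by (simp flip: power_mult)
  have "C = frob_fix l"
    by (rule card_seteq) (use C card card_frob_fix_le[OF prime_char l] in auto)
  then show "frob_fix l \<subseteq> S" "card (frob_fix l :: 'a set) = CHAR('a) ^ l" using C card by auto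
qed

lemma frob_fix_degree_subset:
  assumes S: "is_subring (S :: 'a set)" and x: "x \<in> S"
  shows "frob_fix (frob_degree x) \<subseteq> S" and "card (frob_fix (frob_degree x) :: 'a set) = CHAR('a) ^ frob_degree x"
proof -
  have "frob_fix 1 \<subseteq> S" using prime_subfield[OF prime_char] subringD(9)[OF S] by auto
  then show "frob_fix (frob_degree x) \<subseteq> S" "card (frob_fix (frob_degree x) :: 'a set) = CHAR('a) ^ frob_degree x"
    using frob_fix_lcm[OF S _ _ _ x, of 1] card_frob_fix_1[OF prime_char] by simp_all
qed

text \<open>The proper subfields have at most \<open>q + q^2 + \<dots> + q^(n-1)\<close> elements together, which is less than \<open>q^n\<close>.\<close>
lemma ex_frob_degree:
  assumes n: "n > 0" and card: "card (frob_fix n :: 'a set) = CHAR('a) ^ n"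
  shows "\<exists>x::'a. frob_degree x = n"
proof (rule ccontr)
  assume no: "\<not> ?thesis"
  let ?q = "CHAR('a)"
  have q: "?q \<ge> 2" using prime_char by (rule prime_ge_2_nat)
  have "frob_fix n \<subseteq> (\<Union>d\<in>{1..<n}. frob_fix d :: 'a set)"
  proof
    fix x :: 'a assume "x \<in> frob_fix n"
    then have "frob_degree x \<le> n" using n by (simp add: in_frob_fix_iff dvd_imp_le)
    then have "frob_degree x \<in> {1..<n}" using no frob_degree_pos[of x] by (metis atLeastLessThan_iff le_neq_implies_less Suc_leI One_nat_def)
    then show "x \<in> (\<Union>d\<in>{1..<n}. frob_fix d)" using in_frob_fix_degree by blast
  qed
  then have "card (frob_fix n :: 'a set) \<le> card (\<Union>d\<in>{1..<n}. frob_fix d :: 'a set)"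
    by (intro card_mono finite_UN_I) (auto intro: card_frob_fix_le[OF prime_char])
  also have "\<dots> \<le> (\<Sum>d\<in>{1..<n}. card (frob_fix d :: 'a set))" by (rule card_UN_le) simp
  also have "\<dots> \<le> (\<Sum>d\<in>{1..<n}. ?q ^ d)" by (intro sum_mono card_frob_fix_le[OF prime_char]) auto
  also have "\<dots> < ?q ^ n"
  proof -
    have "(\<Sum>d\<in>{1..<n}. ?q ^ d) < ?q ^ n" if "n > 0" for n
      using that
    proof (induction n rule: nat_induct_non_zero)
      case (Suc n)
      have "(\<Sum>d\<in>{1..<Suc n}. ?q ^ d) = (\<Sum>d\<in>{1..<n}. ?q ^ d) + ?q ^ n" using Suc.hyps by simp
      also have "\<dots> < 2 * ?q ^ n" using Suc.IH by linarith
      also have "\<dots> \<le> ?q ^ Suc n" using q by simp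
      finally show ?case .
    qed (use q in simp)
    then show ?thesis using n .
  qed
  finally show False using card by simp
qed

text \<open>If \<open>d\<close> divides \<open>n\<close>, then \<open>X^(q^d) - X\<close> divides \<open>X^(q^n) - X\<close>. The latter has as many roots as its degree
allows, hence so has each of its divisors.\<close>
lemma card_frob_fix_dvd:
  assumes n: "n > 0" and card: "card (frob_fix n :: 'a set) = CHAR('a) ^ n" and d: "d dvd n"
  shows "card (frob_fix d :: 'a set) = CHAR('a) ^ d"
proof (rule antisym)
  let ?Q = "CHAR('a) ^ d"
  have "d > 0" using n d by (metis dvd_0_left gr0I)
  then show "card (frob_fix d :: 'a set) \<le> ?Q" by (rule card_frob_fix_le[OF prime_char])
  obtain k where k: "n = d * k" using d by blast
  define f :: "nat \<Rightarrow> 'a poly" where "f N = monom 1 N - [:0, 1:]" for N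
  have roots: "frob_fix j = {x. poly (f (CHAR('a) ^ j)) x = 0}" for j
    by (auto simp: f_def frob_fix_def poly_monom)
  have Q: "CHAR('a) ^ j > 1" if "j > 0" for j by (rule one_less_power[OF prime_gt_1_nat[OF prime_char] that])
  have degf: "Polynomial.degree (f N) = N \<and> f N \<noteq> 0" if "N > 1" for N
  proof -
    have "poly.coeff (f N) N = 1" using that by (simp add: f_def coeff_pCons split: nat.split)
    moreover have "Polynomial.degree (f N) \<le> N"
      unfolding f_def using that by (intro degree_diff_le degree_monom_le) auto
    ultimately show ?thesis by (metis coeff_0 le_antisym le_degree zero_neq_one)
  qed
  have "f ?Q dvd f (?Q ^ j)" for j
  proof (induction j)
    case (Suc j)
    let ?X = "[:0, 1:] :: 'a poly" and ?A = "monom 1 (?Q ^ j) :: 'a poly"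
    have "?A - ?X dvd ?A ^ ?Q - ?X ^ ?Q" by (subst power_diff_sumr2) (rule dvd_triv_left)
    then have "f ?Q dvd ?A ^ ?Q - ?X ^ ?Q" using Suc dvd_trans unfolding f_def by blast
    moreover have "f (?Q ^ Suc j) = (?A ^ ?Q - ?X ^ ?Q) + f ?Q"
      by (simp add: f_def monom_power monom_altdef[of 1 ?Q] mult.commute)
    ultimately show ?case by (metis dvd_add dvd_refl)
  qed (simp add: f_def monom_altdef)
  then have "f ?Q dvd f (CHAR('a) ^ n)" by (simp add: k power_mult)
  then obtain h where h: "f (CHAR('a) ^ n) = f ?Q * h" by blast
  have nz: "f ?Q \<noteq> 0" "h \<noteq> 0" using degf[OF Q[OF n]] h by auto
  have "CHAR('a) ^ n = ?Q + Polynomial.degree h"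
    using degf[OF Q[OF n]] degf[OF Q[OF \<open>d > 0\<close>]] h nz by (metis degree_mult_eq)
  moreover have "CHAR('a) ^ n \<le> card (frob_fix d :: 'a set) + Polynomial.degree h"
  proof -
    have "frob_fix n = frob_fix d \<union> {x. poly h x = 0}" unfolding roots h by auto
    then have "card (frob_fix n :: 'a set) \<le> card (frob_fix d :: 'a set) + card {x. poly h x = 0}"
      by (metis card_Un_le)
    also have "card {x. poly h x = 0} \<le> Polynomial.degree h" by (rule card_poly_roots_bound[OF nz(2)])
    finally show ?thesis using card by simp
  qed
  ultimately show "?Q \<le> card (frob_fix d :: 'a set)" by simp
qed

text \<open>This and the next two lemmas form the dictionary between subrings and ideals: \<open>S\<close> corresponds to the set of
degrees of its elements, and \<open>D\<close> to the set of elements with degree in \<open>D\<close>.\<close>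
lemma dvd_ideal_degrees:
  assumes S: "is_subring (S :: 'a set)"
  shows "dvd_ideal (frob_degree ` S)"
proof -
  have full: "n \<in> frob_degree ` S" if n: "n > 0" "frob_fix n \<subseteq> S" "card (frob_fix n :: 'a set) = CHAR('a) ^ n" for n
  proof -
    obtain x :: 'a where x: "frob_degree x = n" using ex_frob_degree n by blast
    then have "x \<in> S" using in_frob_fix_degree[of x] n(2) by blast
    then show ?thesis using x by blast
  qed
  have "1 \<in> frob_degree ` S"
    by (rule full) (use prime_subfield[OF prime_char] subringD(9)[OF S] card_frob_fix_1[OF prime_char] in auto)
  moreover have "0 \<notin> frob_degree ` S" using frob_degree_pos by (metis imageE less_irrefl)
  moreover have "d \<in> frob_degree ` S" if x: "x \<in> S" "d dvd frob_degree x" for x d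
  proof (rule full)
    show "d > 0" using x(2) frob_degree_pos[of x] by (metis dvd_0_left gr0I)
    show "frob_fix d \<subseteq> S"
      using frob_fix_mono[OF prime_char x(2)] frob_fix_degree_subset(1)[OF S x(1)] by blast
    show "card (frob_fix d :: 'a set) = CHAR('a) ^ d"
      by (rule card_frob_fix_dvd[OF frob_degree_pos frob_fix_degree_subset(2)[OF S x(1)] x(2)])
  qed
  moreover have "lcm (frob_degree x) (frob_degree y) \<in> frob_degree ` S" if "x \<in> S" "y \<in> S" for x y
  proof (rule full)
    show "lcm (frob_degree x) (frob_degree y) > 0" by (simp add: frob_degree_pos lcm_pos_nat)
  qed (rule frob_fix_lcm[OF S frob_degree_pos frob_fix_degree_subset[OF S that(1)] that(2)])+
  ultimately show ?thesis unfolding dvd_ideal_def by blast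
qed

lemma degree_vimage_image:
  assumes S: "is_subring (S :: 'a set)"
  shows "frob_degree -` (frob_degree ` S) = S"
proof -
  have "y \<in> S" if "x \<in> S" "frob_degree y = frob_degree x" for x y
    using frob_fix_degree_subset(1)[OF S that(1)] in_frob_fix_degree[of y] that(2) by auto
  then show ?thesis by auto
qed

lemma is_subring_degree_vimage:
  assumes D: "dvd_ideal D"
  shows "is_subring (frob_degree -` D :: 'a set)"
  unfolding is_subring_iff
proof (intro conjI ballI)
  have "(1::'a) \<in> frob_fix 1" by (simp add: frob_fix_def)
  then have "frob_degree (1::'a) = 1" by (simp add: in_frob_fix_iff)
  then show "(1::'a) \<in> frob_degree -` D" using dvd_idealD(1)[OF D] by simp
  fix x y :: 'a assume xy: "x \<in> frob_degree -` D" "y \<in> frob_degree -` D"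
  let ?l = "lcm (frob_degree x) (frob_degree y)"
  have l: "?l \<in> D" using xy dvd_idealD(4)[OF D] by simp
  have "x \<in> frob_fix ?l" "y \<in> frob_fix ?l" by (simp_all add: in_frob_fix_iff)
  then have "x - y \<in> frob_fix ?l" "x * y \<in> frob_fix ?l"
    by (auto intro: subringD[OF is_subring_frob_fix[OF prime_char]])
  then show "x - y \<in> frob_degree -` D" "x * y \<in> frob_degree -` D"
    using dvd_idealD(3)[OF D l] by (simp_all add: in_frob_fix_iff)
qed

lemma is_GF_iff:
  assumes n: "n > 0"
  shows "is_GF n (K :: 'a set) \<longleftrightarrow> K = frob_fix n \<and> n \<in> range (frob_degree :: 'a \<Rightarrow> nat)"
proof
  assume "is_GF n K"
  then have K: "is_subfield K" "finite K" "card K = CHAR('a) ^ n" by (auto simp: is_GF_def)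
  have sub: "is_subring K" by (rule subfieldE(1)[OF K(1)])
  have "K \<subseteq> frob_fix n"
    using power_card_finite_subring[OF sub K(2)] by (auto simp: frob_fix_def K(3))
  then have "K = frob_fix n"
    by (rule card_seteq[OF card_frob_fix_le(1)[OF prime_char n]]) (use K(3) card_frob_fix_le(2)[OF prime_char n] in simp)
  then show "K = frob_fix n \<and> n \<in> range (frob_degree :: 'a \<Rightarrow> nat)"
    using ex_frob_degree[OF n] K(3) by blast
next
  assume K: "K = frob_fix n \<and> n \<in> range (frob_degree :: 'a \<Rightarrow> nat)"
  then obtain x :: 'a where x: "frob_degree x = n" by blast
  have card: "card K = CHAR('a) ^ n" using frob_fix_degree_subset(2)[OF is_subring_UNIV, of x] x K by simp
  interpret R: field "ring_of_type_algebra :: 'a ring" by (rule field_from_type_algebra)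
  have "is_subfield K"
  proof (rule R.subfieldI')
    show "is_subring K" using K is_subring_frob_fix[OF prime_char] by simp
    fix k assume "k \<in> K - {\<zero>\<^bsub>ring_of_type_algebra\<^esub>}"
    then have k: "k \<in> frob_fix n" "k \<noteq> 0" using K by (auto simp: ring_of_type_algebra_def)
    have "m_inv ring_of_type_algebra k = inverse k"
      by (rule R.comm_inv_char) (use k in \<open>auto simp: ring_of_type_algebra_def\<close>)
    moreover have "inverse k \<in> frob_fix n" using k by (simp add: frob_fix_def power_inverse)
    ultimately show "m_inv ring_of_type_algebra k \<in> K" using K by simp
  qed
  then show "is_GF n K" using K card card_frob_fix_le(1)[OF prime_char n] by (simp add: is_GF_def)
qed

text \<open>A field with \<open>q^n\<close> elements has an element of degree \<open>n\<close>, and an element of degree \<open>n\<close> generates such a field.\<close>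
lemma FG_eq: "FG TYPE('a) = range (frob_degree :: 'a \<Rightarrow> nat)"
  unfolding FG_def using is_GF_iff frob_degree_pos by auto

lemma L_field_eq: "(L_field :: 'a set) = frob_degree -` T_prime (FG TYPE('a))"
proof (intro equalityI subsetI)
  fix x :: 'a assume "x \<in> L_field"
  then obtain n K where n: "n \<in> T_prime (FG TYPE('a))" "is_GF n K" "x \<in> K" by (auto simp: L_field_def)
  then have "n > 0" by (simp add: T_prime_def)
  then have "frob_degree x dvd n" using n is_GF_iff in_frob_fix_iff by blast
  then show "x \<in> frob_degree -` T_prime (FG TYPE('a))"
    using n(1) frob_degree_pos[of x] by (auto simp: T_prime_def intro: dvd_trans)
next
  fix x :: 'a assume x: "x \<in> frob_degree -` T_prime (FG TYPE('a))"
  then have "is_GF (frob_degree x) (frob_fix (frob_degree x) :: 'a set)"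
    using is_GF_iff[OF frob_degree_pos] by blast
  then show "x \<in> L_field" unfolding L_field_def using x in_frob_fix_degree by blast
qed

end

section \<open>Chains of subrings of an absolutely algebraic field\<close>

context
  assumes aa: "absolutely_algebraic TYPE('a::field)"
begin

lemma degrees_of_vimage:
  assumes "D \<subseteq> frob_degree ` (R :: 'a set)"
  shows "frob_degree ` (frob_degree -` D :: 'a set) = D"
  using assms by auto

text \<open>The dictionary between subrings and ideals preserves strict inclusion in both directions, so it matches maximal
subrings with maximal ideals.\<close>
lemma maximal_subring_iff:
  assumes R: "is_subring (R :: 'a set)"
  shows "maximal_subring S R \<longleftrightarrow>
    (\<exists>p\<in>T_fin (frob_degree ` R). S = frob_degree -` lower_ideal (frob_degree ` R) p)"
proof -
  let ?D = "frob_degree ` R"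
  have D: "dvd_ideal ?D" by (rule dvd_ideal_degrees[OF aa R])
  have strict: "frob_degree ` S \<subset> frob_degree ` R \<longleftrightarrow> S \<subset> R" if S: "is_subring S" and R: "is_subring R" for S R :: "'a set"
  proof -
    have "S \<subseteq> R" if "frob_degree ` S \<subseteq> frob_degree ` R"
      using vimage_mono[OF that, of "frob_degree :: 'a \<Rightarrow> nat"]
      by (simp only: degree_vimage_image[OF aa] S R)
    moreover have "R \<subseteq> S" if "frob_degree ` R \<subseteq> frob_degree ` S"
      using vimage_mono[OF that, of "frob_degree :: 'a \<Rightarrow> nat"]
      by (simp only: degree_vimage_image[OF aa] S R)
    ultimately show ?thesis by (metis image_mono psubsetE psubsetI subset_antisym)
  qed
  have iff: "maximal_subring S R \<longleftrightarrow> maximal_dvd_ideal (frob_degree ` S) ?D" if S: "is_subring S"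
  proof
    assume max: "maximal_subring S R"
    then have "S \<subset> R" by (simp add: maximal_subring_def)
    then have "frob_degree ` S \<subset> ?D" using strict[OF S R] by simp
    moreover have "D' = frob_degree ` S"
      if D': "dvd_ideal D'" "D' \<subset> ?D" "frob_degree ` S \<subseteq> D'" for D'
    proof -
      let ?S = "frob_degree -` D' :: 'a set"
      have sub: "is_subring ?S" by (rule is_subring_degree_vimage[OF aa D'(1)])
      have eq: "frob_degree ` ?S = D'" by (rule degrees_of_vimage) (use D'(2) in blast)
      have "?S \<subset> R" using strict[OF sub R] D'(2) eq by simp
      moreover have "S \<subseteq> ?S" using D'(3) by blast
      ultimately have "?S = S" using max sub unfolding maximal_subring_def by blast
      then show ?thesis using eq by simp
    qed
    ultimately show "maximal_dvd_ideal (frob_degree ` S) ?D"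
      unfolding maximal_dvd_ideal_def using dvd_ideal_degrees[OF aa S] by blast
  next
    assume max: "maximal_dvd_ideal (frob_degree ` S) ?D"
    then have "frob_degree ` S \<subset> ?D" by (simp add: maximal_dvd_ideal_def)
    then have "S \<subset> R" using strict[OF S R] by simp
    moreover have "S' = S" if S': "is_subring S'" "S' \<subset> R" "S \<subseteq> S'" for S'
    proof -
      have "frob_degree ` S' \<subset> ?D" "frob_degree ` S \<subseteq> frob_degree ` S'"
        using strict[OF S'(1) R] S'(2,3) by auto
      then have "frob_degree ` S' = frob_degree ` S"
        using max dvd_ideal_degrees[OF aa S'(1)] unfolding maximal_dvd_ideal_def by blast
      then show ?thesis using degree_vimage_image[OF aa S] degree_vimage_image[OF aa S'(1)] by simp
    qed
    ultimately show "maximal_subring S R" unfolding maximal_subring_def using S by blast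
  qed
  show ?thesis
  proof
    assume max: "maximal_subring S R"
    then have S: "is_subring S" by (simp add: maximal_subring_def)
    then obtain p where "p \<in> T_fin ?D" "frob_degree ` S = lower_ideal ?D p"
      using iff[OF S] max maximal_dvd_ideal_iff[OF D] by auto
    then show "\<exists>p\<in>T_fin ?D. S = frob_degree -` lower_ideal ?D p"
      using degree_vimage_image[OF aa S] by metis
  next
    assume "\<exists>p\<in>T_fin ?D. S = frob_degree -` lower_ideal ?D p"
    then obtain p where p: "p \<in> T_fin ?D" "S = frob_degree -` lower_ideal ?D p" by blast
    have S: "is_subring S" unfolding p(2) by (rule is_subring_degree_vimage[OF aa dvd_ideal_lower[OF D p(1)]])
    have "frob_degree ` S = lower_ideal ?D p" unfolding p(2)
      by (rule degrees_of_vimage) (auto simp: lower_ideal_def)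
    then show "maximal_subring S R" using iff[OF S] maximal_lower_ideal[OF D p(1)] by simp
  qed
qed

lemma degrees_of_maximal_subring:
  assumes R: "is_subring (R :: 'a set)" and max: "maximal_subring S R"
  obtains p where "p \<in> T_fin (frob_degree ` R)" "frob_degree ` S = lower_ideal (frob_degree ` R) p"
proof -
  obtain p where p: "p \<in> T_fin (frob_degree ` R)" "S = frob_degree -` lower_ideal (frob_degree ` R) p"
    using maximal_subring_iff[OF R] max by blast
  have "frob_degree ` S = lower_ideal (frob_degree ` R) p" unfolding p(2)
    by (rule degrees_of_vimage) (auto simp: lower_ideal_def)
  then show ?thesis using p(1) that by blast
qed

text \<open>Different primes in \<open>T_fin\<close> give different maximal subrings because they remove different pairs from \<open>levels\<close>.\<close>
lemma finite_maximal_subrings_iff: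
  assumes R: "is_subring (R :: 'a set)"
  shows "finite {S. maximal_subring S R} \<longleftrightarrow> finite (T_fin (frob_degree ` R))"
proof -
  let ?D = "frob_degree ` R" and ?f = "\<lambda>p. frob_degree -` lower_ideal (frob_degree ` R) p :: 'a set"
  have D: "dvd_ideal ?D" by (rule dvd_ideal_degrees[OF aa R])
  have eq: "{S. maximal_subring S R} = ?f ` T_fin ?D" using maximal_subring_iff[OF R] by auto
  have "inj_on ?f (T_fin ?D)"
  proof (rule inj_onI)
    fix p r assume p: "p \<in> T_fin ?D" and r: "r \<in> T_fin ?D" and "?f p = ?f r"
    moreover have "frob_degree ` ?f s = lower_ideal ?D s" for s
      by (rule degrees_of_vimage) (auto simp: lower_ideal_def)
    ultimately have "lower_ideal ?D p = lower_ideal ?D r" by metis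
    then have "levels ?D - {(p, o_exp ?D p)} = levels ?D - {(r, o_exp ?D r)}"
      using levels_lower_ideal[OF D p] levels_lower_ideal[OF D r] by simp
    then show "p = r" using top_level_in_levels[OF D p] top_level_in_levels[OF D r] by blast
  qed
  then show ?thesis unfolding eq by (rule finite_image_iff)
qed

text \<open>Removing one pair from an infinite set of levels leaves an infinite set, so the next step is always possible.\<close>
lemma ex_infinite_chain:
  assumes inf: "infinite (T_fin (range (frob_degree :: 'a \<Rightarrow> nat)))"
  shows "\<exists>R :: nat \<Rightarrow> 'a set. infinite_maximal_subring_chain R"
proof -
  let ?P = "\<lambda>n (R :: 'a set). is_subring R \<and> infinite (T_fin (frob_degree ` R)) \<and> (n = 0 \<longrightarrow> R = UNIV)"
  have "\<exists>R. \<forall>n. ?P n (R n) \<and> maximal_subring (R (Suc n)) (R n)"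
  proof (rule dependent_nat_choice)
    show "\<exists>R. ?P 0 R" using inf by (intro exI[of _ UNIV]) (simp add: is_subring_UNIV)
    fix R :: "'a set" and n :: nat assume R: "?P n R"
    let ?D = "frob_degree ` R"
    have D: "dvd_ideal ?D" using R dvd_ideal_degrees[OF aa] by blast
    obtain p where p: "p \<in> T_fin ?D" using R by (metis ex_in_conv finite.emptyI)
    then have max: "maximal_subring (frob_degree -` lower_ideal ?D p) R"
      using R maximal_subring_iff by blast
    have eq: "frob_degree ` (frob_degree -` lower_ideal ?D p :: 'a set) = lower_ideal ?D p"
      by (rule degrees_of_vimage) (auto simp: lower_ideal_def)
    have "infinite (levels ?D)" using R finite_levels_iff[OF D] by blast
    then have "infinite (levels (lower_ideal ?D p))" by (simp add: levels_lower_ideal[OF D p])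
    then have "infinite (T_fin (lower_ideal ?D p))" using finite_levels_iff[OF dvd_ideal_lower[OF D p]] by blast
    then have "?P (Suc n) (frob_degree -` lower_ideal ?D p)"
      using max eq by (simp add: maximal_subring_def)
    then show "\<exists>R'. ?P (Suc n) R' \<and> maximal_subring R' R" using max by blast
  qed
  then show ?thesis unfolding infinite_maximal_subring_chain_def by blast
qed

text \<open>The invariants of a chain. It is stated for sequences of which only the first \<open>n\<close> terms matter, in order to cover
finite and infinite chains alike.\<close>
lemma chain_levels:
  assumes fin: "finite (T_fin (range (frob_degree :: 'a \<Rightarrow> nat)))"
    and R0: "R 0 = (UNIV :: 'a set)" and step: "\<And>i. Suc i < n \<Longrightarrow> maximal_subring (R (Suc i)) (R i)"
  shows "i < n \<Longrightarrow> is_subring (R i) \<and> finite (levels (frob_degree ` R i)) \<and>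
    card (levels (frob_degree ` R i)) + i = card (levels (range (frob_degree :: 'a \<Rightarrow> nat))) \<and>
    T_inf (frob_degree ` R i) = T_inf (range (frob_degree :: 'a \<Rightarrow> nat))"
proof (induction i)
  case 0
  have "dvd_ideal (range (frob_degree :: 'a \<Rightarrow> nat))" by (rule dvd_ideal_degrees[OF aa is_subring_UNIV])
  then show ?case using fin R0 by (simp add: is_subring_UNIV finite_levels_iff)
next
  case (Suc i)
  let ?D = "frob_degree ` R i" and ?D' = "frob_degree ` R (Suc i)"
  have R: "is_subring (R i)" using Suc by simp
  have D: "dvd_ideal ?D" by (rule dvd_ideal_degrees[OF aa R])
  have max: "maximal_subring (R (Suc i)) (R i)" by (rule step) (use Suc.prems in simp)
  obtain p where p: "p \<in> T_fin ?D" "?D' = lower_ideal ?D p"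
    by (rule degrees_of_maximal_subring[OF R max])
  have lev: "levels ?D' = levels ?D - {(p, o_exp ?D p)}"
    unfolding p(2) by (rule levels_lower_ideal[OF D p(1)])
  have "card (levels ?D) = Suc (card (levels ?D'))"
    unfolding lev by (rule card.remove) (use Suc top_level_in_levels[OF D p(1)] in auto)
  moreover have "T_inf ?D' = T_inf ?D" unfolding p(2) by (rule T_inf_lower_ideal[OF D p(1)])
  ultimately show ?case using Suc max lev by (simp add: maximal_subring_def)
qed

lemma no_infinite_chain:
  assumes fin: "finite (T_fin (range (frob_degree :: 'a \<Rightarrow> nat)))"
  shows "\<not> infinite_maximal_subring_chain (R :: nat \<Rightarrow> 'a set)"
proof
  assume R: "infinite_maximal_subring_chain R"
  let ?n = "card (levels (range (frob_degree :: 'a \<Rightarrow> nat)))"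
  have "card (levels (frob_degree ` R (Suc ?n))) + Suc ?n = ?n"
    using chain_levels[OF fin, of R "Suc (Suc ?n)" "Suc ?n"] R
    by (simp add: infinite_maximal_subring_chain_def)
  then show False by simp
qed

lemma unextendable_chain_length_and_last:
  assumes fin: "finite (T_fin (range (frob_degree :: 'a \<Rightarrow> nat)))"
    and Rs: "unextendable_chain (Rs :: 'a set list)"
  shows "length Rs = Suc (card (levels (range (frob_degree :: 'a \<Rightarrow> nat))))" and "last Rs = L_field"
proof -
  let ?T = "range (frob_degree :: 'a \<Rightarrow> nat)"
  have chain: "Rs \<noteq> []" "Rs ! 0 = UNIV" "\<And>i. Suc i < length Rs \<Longrightarrow> maximal_subring (Rs ! Suc i) (Rs ! i)"
    and no: "\<And>S. \<not> maximal_subring S (last Rs)"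
    using Rs by (auto simp: unextendable_chain_def maximal_subring_chain_def hd_conv_nth)
  let ?i = "length Rs - 1" and ?D = "frob_degree ` last Rs"
  have last: "last Rs = Rs ! ?i" using chain(1) by (rule last_conv_nth)
  have L: "is_subring (last Rs)" "card (levels ?D) + ?i = card (levels ?T)" "T_inf ?D = T_inf ?T"
    using chain_levels[OF fin, of "nth Rs" "length Rs" ?i] chain unfolding last by auto
  have D: "dvd_ideal ?D" by (rule dvd_ideal_degrees[OF aa L(1)])
  have empty: "T_fin ?D = {}" using no maximal_subring_iff[OF L(1)] by blast
  then have "levels ?D = {}" by (simp add: levels_empty_iff[OF D])
  then show "length Rs = Suc (card (levels ?T))" using L(2) chain(1) by (cases Rs) auto
  have "?D = T_prime ?D" by (rule eq_T_prime_if_no_T_fin[OF D empty])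
  also have "\<dots> = T_prime (FG TYPE('a))" using L(3) by (simp add: T_prime_def FG_eq[OF aa])
  finally show "last Rs = L_field"
    using degree_vimage_image[OF aa L(1)] L_field_eq[OF aa] by simp
qed

lemma finite_chains:
  assumes fin: "finite (T_fin (range (frob_degree :: 'a \<Rightarrow> nat)))"
  shows "finite {Rs :: 'a set list. maximal_subring_chain Rs \<and> length Rs = n}"
proof (induction n)
  case 0
  then show ?case by (simp add: maximal_subring_chain_def)
next
  case (Suc n)
  let ?A = "\<lambda>n. {Rs :: 'a set list. maximal_subring_chain Rs \<and> length Rs = n}"
  have "?A (Suc n) \<subseteq> {[UNIV]} \<union> (\<Union>Rs\<in>?A n. (\<lambda>S. Rs @ [S]) ` {S. maximal_subring S (last Rs)})"
  proof
    fix Rs assume Rs: "Rs \<in> ?A (Suc n)"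
    then obtain Rs' S where eq: "Rs = Rs' @ [S]" by (metis (mono_tags, lifting) mem_Collect_eq length_Suc_conv_rev)
    have chain: "hd Rs = UNIV" "\<And>i. Suc i < length Rs \<Longrightarrow> maximal_subring (Rs ! Suc i) (Rs ! i)"
      using Rs by (auto simp: maximal_subring_chain_def)
    show "Rs \<in> {[UNIV]} \<union> (\<Union>Rs\<in>?A n. (\<lambda>S. Rs @ [S]) ` {S. maximal_subring S (last Rs)})"
    proof (cases "Rs' = []")
      case True
      then show ?thesis using eq chain(1) by simp
    next
      case False
      have "maximal_subring S (last Rs')"
        using chain(2)[of "length Rs' - 1"] False by (simp add: eq nth_append last_conv_nth)
      moreover have "maximal_subring (Rs' ! Suc i) (Rs' ! i)" if "Suc i < length Rs'" for i
        using chain(2)[of i] that by (simp add: eq nth_append)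
      then have "maximal_subring_chain Rs'"
        using False chain(1) by (simp add: maximal_subring_chain_def eq)
      ultimately show ?thesis using Rs eq by auto
    qed
  qed
  moreover have "finite {S. maximal_subring S (last Rs)}" if Rs: "Rs \<in> ?A n" for Rs
  proof -
    have chain: "Rs \<noteq> []" "Rs ! 0 = UNIV" "\<And>i. Suc i < length Rs \<Longrightarrow> maximal_subring (Rs ! Suc i) (Rs ! i)"
      using Rs by (auto simp: maximal_subring_chain_def hd_conv_nth)
    then have L: "is_subring (last Rs)" "finite (levels (frob_degree ` last Rs))"
      using chain_levels[OF fin, of "nth Rs" "length Rs" "length Rs - 1"] by (auto simp: last_conv_nth)
    show ?thesis
      unfolding finite_maximal_subrings_iff[OF L(1)]
      using L(2) finite_levels_iff[OF dvd_ideal_degrees[OF aa L(1)]] by simp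
  qed
  ultimately show ?case
    using Suc.IH by (elim finite_subset) (intro finite_UnI finite_UN_I finite_imageI; simp)
qed

end

section \<open>The equivalence\<close>

theorem theorem2p6:
  fixes T :: "nat set"
  defines "T \<equiv> FG TYPE('a::field)"
  shows "(finite {S :: 'a set. maximal_subring S UNIV} \<longleftrightarrow>
           \<not> (\<exists>R :: nat \<Rightarrow> 'a set. infinite_maximal_subring_chain R)) \<and>
         (finite {S :: 'a set. maximal_subring S UNIV} \<or>
           \<not> (\<exists>R :: nat \<Rightarrow> 'a set. infinite_maximal_subring_chain R) \<longrightarrow>
           (\<exists>m. (\<forall>Rs :: 'a set list. unextendable_chain Rs \<longrightarrow>
                    length Rs = Suc m \<and> last Rs = L_field) \<and>
                finite {Rs :: 'a set list. unextendable_chain Rs} \<and>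
                finite (T_fin T) \<and> m = (\<Sum>p\<in>T_fin T. o_exp T p)))"
proof (cases "absolutely_algebraic TYPE('a)")
  case True
  have T: "T = range (frob_degree :: 'a \<Rightarrow> nat)" unfolding T_def by (rule FG_eq[OF True])
  have ideal: "dvd_ideal T" unfolding T by (rule dvd_ideal_degrees[OF True is_subring_UNIV])
  have fin_iff: "finite {S :: 'a set. maximal_subring S UNIV} \<longleftrightarrow> finite (T_fin T)"
    unfolding T by (rule finite_maximal_subrings_iff[OF True is_subring_UNIV])
  moreover have chain_iff: "\<not> (\<exists>R :: nat \<Rightarrow> 'a set. infinite_maximal_subring_chain R) \<longleftrightarrow> finite (T_fin T)"
    unfolding T using ex_infinite_chain[OF True] no_infinite_chain[OF True] by blast
  moreover have "(\<forall>Rs :: 'a set list. unextendable_chain Rs \<longrightarrow>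
        length Rs = Suc (card (levels T)) \<and> last Rs = L_field) \<and>
      finite {Rs :: 'a set list. unextendable_chain Rs}" if fin: "finite (T_fin T)"
  proof -
    have *: "length Rs = Suc (card (levels T)) \<and> last Rs = L_field" if "unextendable_chain Rs" for Rs :: "'a set list"
      using unextendable_chain_length_and_last[OF True fin[unfolded T] that] by (simp add: T)
    have "finite {Rs :: 'a set list. maximal_subring_chain Rs \<and> length Rs = Suc (card (levels T))}"
      by (rule finite_chains[OF True fin[unfolded T]])
    then have "finite {Rs :: 'a set list. unextendable_chain Rs}"
      by (rule rev_finite_subset) (use * in \<open>auto simp: unextendable_chain_def\<close>)
    then show ?thesis using * by blast
  qed
  ultimately show ?thesis using card_levels[OF ideal] by auto
next
  case False
  have "CHAR('a) = 0 \<or> (\<exists>x::'a. transcendental_over (range of_int) x)"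
    using False absolutely_algebraic_if_algebraic prime_CHAR_semidom by blast
  then obtain a and V :: "nat \<Rightarrow> 'a set" where "independent_subrings a V"
    using ex_independent_subrings_if_not_algebraic by blast
  then show ?thesis
    using infinite_maximal_subrings_if_independent infinite_chain_if_independent by blast
qed

end
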